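(* Every sufficiently regular solution of the kinetic equation below on the periodic cell obeys, for each species $s$ and each $m\ge1$, $$\dot A_{s,m}=-\gamma_mA_{s,m}$$ exactly, where $A_{s,m}(t)$ is the global $m$-th angular moment. Periodic and relative-periodic states (periodic up to a spatial translation) therefore have $A_{s,m}=0$ for all $m\ge1$. Moreover, for such a state of period $P$, the linearised period map has the exact left factors $e^{-\gamma_mP}$: the functionals $A_{s,m}$ are mapped by its dual to $e^{-\gamma_mP}A_{s,m}$; and these factors are unchanged by phase alignment (removal of the spatial-translation and temporal phases).
   Context: Kinetic equation: for species $s=1,2$, $x\in\mathbb R/L\mathbb Z$, $\theta\in\mathbb R/2\pi\mathbb Z$, $$\partial_tF_s=-\partial_x(v_s\cos\theta\,F_s)+D_t\partial_x^2F_s+\alpha\int_0^{2\pi}q(\varphi)\,[F_s(x,\theta-\varphi)-F_s(x,\theta)]\,d\varphi,$$ with $D_t,\alpha>0$, $q$ a strictly positive even probability density on the circle, and speeds $v_s=\prod_u[1+0.7\tanh(\eta_{su}(\tilde\rho_u-1)/0.7)]$, $\eta=\begin{pmatrix}-2&0.5\\-0.5&-2\end{pmatrix}$, depending on $x$ and $t$ only through the sensed densities $\tilde\rho_u$ (the densities $\rho_u=\int F_u\,d\theta/2\pi$ convolved with the radial kernel $K(r)=3(1-r)/\pi$, $0\le r\le1$). Rates: $\gamma_m=\alpha(1-\int q\cos m\varphi\,d\varphi)$, so $\gamma_m>0$ for $m\ge1$. Global moments: $A_{s,m}(t)=\int_0^L\int_0^{2\pi}F_s(x,\theta,t)\cos(m\theta)\,\frac{d\theta}{2\pi}\,dx$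 (any fixed normalisation). *)

theory Defs
  imports "HOL-Analysis.Analysis"
begin

text \<open>
  A state assigns to species, position and angle the density \<open>G s x \<theta>\<close>. The circles of lengths
  \<open>L\<close> and \<open>2 * pi\<close> are encoded by periodicity on the real line.
\<close>

type_synonym state = "2 \<Rightarrow> real \<Rightarrow> real \<Rightarrow> real"

definition cell_periodic :: "real \<Rightarrow> state \<Rightarrow> bool" where
  "cell_periodic L G \<longleftrightarrow>
     (\<forall>s x \<theta>. G s (x + L) \<theta> = G s x \<theta> \<and> G s x (\<theta> + 2 * pi) = G s x \<theta>)"

definition circle_density :: "(real \<Rightarrow> real) \<Rightarrow> bool" where
  "circle_density q \<longleftrightarrow>
     (\<forall>\<phi>. q \<phi> > 0 \<and> q (- \<phi>) = q \<phi> \<and> q (\<phi> + 2 * pi) = q \<phi>) \<and>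
     (q has_integral 1) {0..2 * pi}"

definition density :: "state \<Rightarrow> 2 \<Rightarrow> real \<Rightarrow> real" where
  "density G u x = integral {0..2 * pi} (\<lambda>\<theta>. G u x \<theta>) / (2 * pi)"

definition sensing_kernel :: "real \<Rightarrow> real" where
  "sensing_kernel r = (if 0 \<le> r \<and> r \<le> 1 then 3 * (1 - r) / pi else 0)"

text \<open>
  The radial kernel has unit mass on the planar unit disc, so the convolution is the planar one,
  applied to a density that depends on the first coordinate only.
\<close>

definition sensed_density :: "state \<Rightarrow> 2 \<Rightarrow> real \<Rightarrow> real" where
  "sensed_density G u x =
     integral UNIV (\<lambda>y :: real^2. sensing_kernel (norm y) * density G u (x - y $ 1))"

definition eta :: "real^2^2" where
  "eta = vector [vector [-2, 0.5], vector [-0.5, -2]]"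

definition speed :: "state \<Rightarrow> 2 \<Rightarrow> real \<Rightarrow> real" where
  "speed G s x =
     (\<Prod>u\<in>UNIV. 1 + 0.7 * tanh (eta $ s $ u * (sensed_density G u x - 1) / 0.7))"

definition kinetic_rhs :: "real \<Rightarrow> real \<Rightarrow> (real \<Rightarrow> real) \<Rightarrow> state \<Rightarrow> state" where
  "kinetic_rhs Dt \<alpha> q G s x \<theta> =
     - deriv (\<lambda>y. speed G s y * cos \<theta> * G s y \<theta>) x
     + Dt * (deriv ^^ 2) (\<lambda>y. G s y \<theta>) x
     + \<alpha> * integral {0..2 * pi} (\<lambda>\<phi>. q \<phi> * (G s x (\<theta> - \<phi>) - G s x \<theta>))"

definition rate :: "real \<Rightarrow> (real \<Rightarrow> real) \<Rightarrow> nat \<Rightarrow> real" where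
  "rate \<alpha> q m = \<alpha> * (1 - integral {0..2 * pi} (\<lambda>\<phi>. q \<phi> * cos (real m * \<phi>)))"

definition moment :: "real \<Rightarrow> 2 \<Rightarrow> nat \<Rightarrow> state \<Rightarrow> real" where
  "moment L s m G =
     integral {0..L} (\<lambda>x. integral {0..2 * pi} (\<lambda>\<theta>. G s x \<theta> * cos (real m * \<theta>) / (2 * pi)))"

text \<open>
  Regularity is that of a classical solution: one time derivative and two space derivatives,
  all jointly continuous. No differentiability in the angle is needed.
\<close>

definition regular_states :: "real \<Rightarrow> state set" where
  "regular_states L = {G. cell_periodic L G \<and>
     (\<forall>s. \<exists>Gx Gxx.
        continuous_on UNIV (\<lambda>(x, \<theta>). G s x \<theta>) \<and>
        continuous_on UNIV (\<lambda>(x, \<theta>). Gx x \<theta>) \<and>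
        continuous_on UNIV (\<lambda>(x, \<theta>). Gxx x \<theta>) \<and>
        (\<forall>x \<theta>. ((\<lambda>y. G s y \<theta>) has_real_derivative Gx x \<theta>) (at x) \<and>
               ((\<lambda>y. Gx y \<theta>) has_real_derivative Gxx x \<theta>) (at x)))}"

definition regular_evolution ::
  "real \<Rightarrow> real set \<Rightarrow> (real \<Rightarrow> state) \<Rightarrow> (real \<Rightarrow> state) \<Rightarrow> bool" where
  "regular_evolution L I F F' \<longleftrightarrow> (\<forall>t\<in>I. cell_periodic L (F t)) \<and>
     (\<forall>s. \<exists>Fx Fxx.
        continuous_on (I \<times> UNIV) (\<lambda>(t, x, \<theta>). F t s x \<theta>) \<and>
        continuous_on (I \<times> UNIV) (\<lambda>(t, x, \<theta>). F' t s x \<theta>) \<and>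
        continuous_on (I \<times> UNIV) (\<lambda>(t, x, \<theta>). Fx t x \<theta>) \<and>
        continuous_on (I \<times> UNIV) (\<lambda>(t, x, \<theta>). Fxx t x \<theta>) \<and>
        (\<forall>t\<in>I. \<forall>x \<theta>.
           ((\<lambda>\<tau>. F \<tau> s x \<theta>) has_real_derivative F' t s x \<theta>) (at t within I) \<and>
           ((\<lambda>y. F t s y \<theta>) has_real_derivative Fx t x \<theta>) (at x) \<and>
           ((\<lambda>y. Fx t y \<theta>) has_real_derivative Fxx t x \<theta>) (at x)))"

definition regular_solution ::
  "real \<Rightarrow> real \<Rightarrow> real \<Rightarrow> (real \<Rightarrow> real) \<Rightarrow> real set \<Rightarrow> (real \<Rightarrow> state) \<Rightarrow> bool" where
  "regular_solution L Dt \<alpha> q I F \<longleftrightarrow> is_interval I \<and>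
     (\<exists>F'. regular_evolution L I F F' \<and>
       (\<forall>t\<in>I. \<forall>s x \<theta>. F' t s x \<theta> = kinetic_rhs Dt \<alpha> q (F t) s x \<theta>))"

definition translate :: "real \<Rightarrow> state \<Rightarrow> state" where
  "translate a G = (\<lambda>s x \<theta>. G s (x - a) \<theta>)"

text \<open>Periodic states are the case \<open>a = 0\<close>.\<close>

definition relative_periodic_state ::
  "real \<Rightarrow> real \<Rightarrow> real \<Rightarrow> (real \<Rightarrow> real) \<Rightarrow> real \<Rightarrow> real \<Rightarrow> (real \<Rightarrow> state) \<Rightarrow> bool" where
  "relative_periodic_state L Dt \<alpha> q P a F \<longleftrightarrow>
     regular_solution L Dt \<alpha> q UNIV F \<and> P > 0 \<and> (\<forall>t. F (t + P) = translate a (F t))"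

text \<open>
  The linearised right-hand side at \<open>F t\<close> in direction \<open>g t\<close> is the directional derivative of
  the full nonlinear right-hand side, including the variation of the speeds.
\<close>

definition linearised_solution ::
  "real \<Rightarrow> real \<Rightarrow> real \<Rightarrow> (real \<Rightarrow> real) \<Rightarrow> (real \<Rightarrow> state) \<Rightarrow> real set \<Rightarrow> (real \<Rightarrow> state) \<Rightarrow> bool"
  where
  "linearised_solution L Dt \<alpha> q F I g \<longleftrightarrow> is_interval I \<and>
     (\<exists>g'. regular_evolution L I g g' \<and>
       (\<forall>t\<in>I. \<forall>s x \<theta>.
          ((\<lambda>\<epsilon>. kinetic_rhs Dt \<alpha> q (\<lambda>s x \<theta>. F t s x \<theta> + \<epsilon> * g t s x \<theta>) s x \<theta>)
             has_real_derivative g' t s x \<theta>) (at 0)))"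

text \<open>
  \<open>M\<close> carries an initial perturbation of \<open>F 0\<close> along the linearised equation over one period and
  then undoes the spatial shift, so that the result is again a perturbation of \<open>F 0\<close>.
\<close>

definition linearised_period_map ::
  "real \<Rightarrow> real \<Rightarrow> real \<Rightarrow> (real \<Rightarrow> real) \<Rightarrow> real \<Rightarrow> real \<Rightarrow> (real \<Rightarrow> state) \<Rightarrow> (state \<Rightarrow> state) \<Rightarrow> bool"
  where
  "linearised_period_map L Dt \<alpha> q P a F M \<longleftrightarrow>
     (\<forall>h\<in>regular_states L. \<exists>g. linearised_solution L Dt \<alpha> q F {0..P} g \<and>
        g 0 = h \<and> M h = translate (- a) (g P))"

definition dual_map :: "state set \<Rightarrow> (state \<Rightarrow> state) \<Rightarrow> (state \<Rightarrow> real) \<Rightarrow> (state \<Rightarrow> real)" where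
  "dual_map X M l = restrict (l \<circ> M) X"

definition left_factor ::
  "state set \<Rightarrow> (state \<Rightarrow> state) \<Rightarrow> (state \<Rightarrow> real) \<Rightarrow> real \<Rightarrow> bool" where
  "left_factor X M l \<mu> \<longleftrightarrow> (\<exists>h\<in>X. l h \<noteq> 0) \<and> dual_map X M l = (\<lambda>h\<in>X. \<mu> * l h)"

definition linear_functional_on :: "state set \<Rightarrow> (state \<Rightarrow> real) \<Rightarrow> bool" where
  "linear_functional_on X l \<longleftrightarrow>
     (\<forall>h\<in>X. \<forall>k\<in>X. \<forall>c d. l (\<lambda>s x \<theta>. c * h s x \<theta> + d * k s x \<theta>) = c * l h + d * l k)"

definition translation_phase :: "(real \<Rightarrow> state) \<Rightarrow> state" where
  "translation_phase F = (\<lambda>s x \<theta>. deriv (\<lambda>y. F 0 s y \<theta>) x)"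

definition temporal_phase :: "(real \<Rightarrow> state) \<Rightarrow> state" where
  "temporal_phase F = (\<lambda>s x \<theta>. deriv (\<lambda>t. F t s x \<theta>) 0)"

text \<open>
  To first order, aligning the phases of a perturbation of \<open>F 0\<close> subtracts multiples of the two
  phase directions. The multiples \<open>a h\<close> and \<open>b h\<close> come from whatever phase conditions are imposed;
  these conditions must remove both phase directions completely. The two directions may be
  linearly dependent, as for travelling waves.
\<close>

definition phase_alignment :: "real \<Rightarrow> (real \<Rightarrow> state) \<Rightarrow> (state \<Rightarrow> state) \<Rightarrow> bool" where
  "phase_alignment L F Q \<longleftrightarrow>
     translation_phase F \<in> regular_states L \<and> temporal_phase F \<in> regular_states L \<and>
     (\<exists>a b. linear_functional_on (regular_states L) a \<and> linear_functional_on (regular_states L) b \<and>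
        (\<forall>h\<in>regular_states L.
           Q h = (\<lambda>s x \<theta>. h s x \<theta> - a h * translation_phase F s x \<theta> - b h * temporal_phase F s x \<theta>))) \<and>
     Q (translation_phase F) = (\<lambda>s x \<theta>. 0) \<and> Q (temporal_phase F) = (\<lambda>s x \<theta>. 0)"

end

theory Submission
  imports Defs
begin

text \<open>
  Integrating over the circle of positions kills every total \<open>x\<close>-derivative. The profile
  \<open>\<theta> \<mapsto> \<integral> F s x \<theta> dx\<close> of a solution is therefore insensitive to advection and
  diffusion and obeys a closed equation: its time derivative is \<open>\<alpha>\<close> times the collision operator of the profile.
  The latter is convolution with \<open>q\<close> minus the identity; as \<open>q\<close> is even with mass one, it is diagonal on cosines
  and multiplies the \<open>m\<close>-th one by \<open>\<integral> q cos m\<phi> d\<phi> - 1\<close>. This gives the decay law with rate \<open>\<gamma>\<^sub>m\<close>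
  (\<open>moment_balance\<close>, \<open>moment_ode_solution\<close>).

  Advection enters only through the periodicity of a differentiable flux, so the argument survives linearisation once the derivative \<open>d/d\<epsilon>\<close> of \<open>\<partial>\<^sub>x flux\<close> is known to be the \<open>x\<close>-derivative of something
  periodic, namely of the derivative \<open>d/d\<epsilon>\<close> of the flux. The class \<open>exchangeable\<close> provides this interchange, and
  \<open>transport_free\<close> is the common property of the nonlinear and of the linearised equation from which the decay law follows.

  The moments are invariant under spatial translation. For a relative periodic state \<open>A(t + P) = A(t)\<close> while
  \<open>A(t + P) = exp(- \<gamma>\<^sub>m P) A(t)\<close> with \<open>\<gamma>\<^sub>m > 0\<close>, which forces \<open>A = 0\<close>; for a perturbation the same computation
  over one period says that the moment is a left eigenvector of the period map. Finally both phase directions have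
  vanishing moments: the translation phase is an \<open>x\<close>-derivative, and the temporal phase has moment
  \<open>- \<gamma>\<^sub>m A(0) = 0\<close>. Subtracting multiples of them changes no moment, hence no factor.
\<close>

section \<open>Integration against a merely integrable weight\<close>

lemma continuous_on_slice:
  assumes "continuous_on UNIV (\<lambda>(x, y). g x y)" "continuous_on A f" "continuous_on A h"
  shows "continuous_on A (\<lambda>t. g (f t) (h t))"
  using continuous_on_compose2[OF assms(1) continuous_on_Pair[OF assms(2,3)]] by simp

text \<open>
  The turning density \<open>q\<close> is only assumed to be gauge integrable. Nonnegativity upgrades this to absolute
  integrability, after which bounded measurable factors are harmless.
\<close>
lemma weighted_integrable:
  fixes q h :: "real \<Rightarrow> real"
  assumes q: "q integrable_on {c..d}" "\<And>\<phi>. 0 \<le> q \<phi>" and h: "continuous_on {c..d} h"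
  shows "(\<lambda>\<phi>. q \<phi> * h \<phi>) absolutely_integrable_on {c..d}"
proof -
  have "(\<lambda>\<phi>. h \<phi> * q \<phi>) absolutely_integrable_on {c..d}"
  proof (rule absolutely_integrable_bounded_measurable_product_real)
    show "h \<in> borel_measurable (lebesgue_on {c..d})"
      by (intro continuous_imp_measurable_on_sets_lebesgue h) auto
    show "bounded (h ` {c..d})"
      by (intro compact_imp_bounded compact_continuous_image h) auto
    show "q absolutely_integrable_on {c..d}"
      by (intro nonnegative_absolutely_integrable_1 q)
  qed auto
  then show ?thesis by (simp add: mult.commute)
qed

text \<open>
  Fubini on a rectangle where one factor of the integrand may be discontinuous. It is stated with
  \<open>has_integral\<close> because the integrability of the outer integrand is part of what is needed later.
\<close>
lemma has_integral_weighted_swap: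
  fixes q :: "real \<Rightarrow> real" and H :: "real \<Rightarrow> real \<Rightarrow> real"
  assumes q: "q integrable_on {c..d}" "\<And>\<phi>. 0 \<le> q \<phi>"
    and H: "continuous_on UNIV (\<lambda>(x, \<phi>). H x \<phi>)"
  shows "((\<lambda>x. integral {c..d} (\<lambda>\<phi>. q \<phi> * H x \<phi>)) has_integral
          integral {c..d} (\<lambda>\<phi>. q \<phi> * integral {a..b} (\<lambda>x. H x \<phi>))) {a..b}"
proof -
  let ?M1 = "lebesgue_on {a..b}" and ?M2 = "lebesgue_on {c..d}"
  interpret M1: finite_measure ?M1 by (rule finite_measure_lebesgue_on) simp
  interpret M2: finite_measure ?M2 by (rule finite_measure_lebesgue_on) simp
  interpret pair_sigma_finite ?M1 ?M2 ..
  have qi: "integrable ?M2 q"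
    using nonnegative_absolutely_integrable_1[OF q(1)] q(2)
    by (simp add: set_integrable_def integrable_restrict_space)
  have qm: "q \<in> borel_measurable ?M2"
    using qi by (rule borel_measurable_integrable)
  have idm: "(\<lambda>x. x) \<in> borel_measurable (lebesgue_on S)" for S :: "real set"
    by (simp add: id_borel_measurable_lebesgue_on[unfolded id_def])
  have fm: "fst \<in> borel_measurable (?M1 \<Otimes>\<^sub>M ?M2)"
    by (rule measurable_compose[OF measurable_fst idm])
  have sm: "snd \<in> borel_measurable (?M1 \<Otimes>\<^sub>M ?M2)"
    by (rule measurable_compose[OF measurable_snd idm])
  have Hm: "(\<lambda>p. H (fst p) (snd p)) \<in> borel_measurable (?M1 \<Otimes>\<^sub>M ?M2)"
    using borel_measurable_continuous_Pair[OF fm sm, of H] H by (simp add: case_prod_beta')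
  have qm2: "(\<lambda>p. q (snd p)) \<in> borel_measurable (?M1 \<Otimes>\<^sub>M ?M2)"
    by (rule measurable_compose[OF measurable_snd qm])
  have cont1: "continuous_on {c..d} (H x)" for x
    using continuous_on_slice[OF H, of "{c..d}" "\<lambda>_. x" "\<lambda>y. y"] by (simp add: continuous_intros)
  have cont2: "continuous_on {a..b} (\<lambda>x. H x y)" for y
    using continuous_on_slice[OF H, of "{a..b}" "\<lambda>x. x" "\<lambda>_. y"] by (simp add: continuous_intros)
  have compact: "compact ((\<lambda>(x, \<phi>). H x \<phi>) ` ({a..b} \<times> {c..d}))"
    by (intro compact_continuous_image compact_Times continuous_on_subset[OF H]) auto
  obtain B where B: "\<And>x y. x \<in> {a..b} \<Longrightarrow> y \<in> {c..d} \<Longrightarrow> \<bar>H x y\<bar> \<le> B"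
    using compact_imp_bounded[OF compact] by (fastforce simp: bounded_iff)
  have dom: "integrable (?M1 \<Otimes>\<^sub>M ?M2) (\<lambda>p. B * q (snd p))"
    by (rule Fubini_integrable) (use qm2 qi in auto)
  have int: "integrable (?M1 \<Otimes>\<^sub>M ?M2) (\<lambda>p. q (snd p) * H (fst p) (snd p))"
  proof (rule Bochner_Integration.integrable_bound[OF dom])
    have "\<bar>q y * H x y\<bar> \<le> \<bar>B * q y\<bar>" if "x \<in> {a..b}" "y \<in> {c..d}" for x y
      using mult_left_mono[OF B[OF that] q(2)[of y]] q(2)[of y]
      by (metis abs_ge_self abs_mult abs_of_nonneg mult.commute order_trans)
    then show "AE p in ?M1 \<Otimes>\<^sub>M ?M2. norm (q (snd p) * H (fst p) (snd p)) \<le> norm (B * q (snd p))"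
      by (intro AE_I2) (auto simp: space_pair_measure)
  qed (use Hm qm2 in auto)
  have in2: "(\<integral>y. q y * H x y \<partial>?M2) = integral {c..d} (\<lambda>y. q y * H x y)" for x
    using weighted_integrable[OF q cont1, of x]
    by (intro lebesgue_integral_eq_integral) (auto simp: set_integrable_def integrable_restrict_space)
  have in1: "(\<integral>x. H x y \<partial>?M1) = integral {a..b} (\<lambda>x. H x y)" for y
  proof -
    have "integrable ?M1 (\<lambda>x. H x y)"
      using absolutely_integrable_continuous_real[OF cont2, of y]
      by (simp add: set_integrable_def integrable_restrict_space)
    then show ?thesis
      by (simp add: lebesgue_integral_eq_integral)
  qed
  have i1: "integrable ?M1 (\<lambda>x. integral {c..d} (\<lambda>y. q y * H x y))"
    using integrable_fst'[OF int] by (simp add: in2)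
  have i2: "integrable ?M2 (\<lambda>y. q y * integral {a..b} (\<lambda>x. H x y))"
    using integrable_snd[of "\<lambda>x y. q y * H x y"] int by (simp add: in1 case_prod_beta')
  have eq: "(\<integral>x. integral {c..d} (\<lambda>y. q y * H x y) \<partial>?M1) = integral {c..d} (\<lambda>y. q y * integral {a..b} (\<lambda>x. H x y))"
    using Fubini_integral[of "\<lambda>x y. q y * H x y"] int lebesgue_integral_eq_integral[OF i2]
    by (simp add: in1 in2 case_prod_beta')
  show ?thesis
    using has_integral_integral_lebesgue_on[OF i1] eq by simp
qed

section \<open>Periodic integrals and positivity of the rates\<close>

lemma integral_periodic_shift:
  fixes f :: "real \<Rightarrow> real"
  assumes L: "L > 0" and f: "continuous_on UNIV f" and per: "\<And>x. f (x + L) = f x"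
  shows "integral {0..L} (\<lambda>x. f (x + c)) = integral {0..L} f"
proof -
  have pern: "f (x + of_nat n * L) = f x" for x n
  proof (induction n)
    case (Suc n)
    then show ?case using per[of "x + of_nat n * L"] by (simp add: algebra_simps)
  qed simp
  have peri: "f (x + of_int k * L) = f x" for x k
  proof (cases "k \<ge> 0")
    case True
    then show ?thesis using pern[of x "nat k"] by simp
  next
    case False
    then show ?thesis using pern[of "x + of_int k * L" "nat (- k)"] by simp
  qed
  define k where "k = \<lfloor>c / L\<rfloor>"
  define r where "r = c - of_int k * L"
  have r: "0 \<le> r" "r \<le> L"
    using mult_right_mono[OF of_int_floor_le, of L "c / L"]
      mult_right_mono[OF real_of_int_floor_add_one_ge, of L "c / L"] L
    unfolding r_def k_def by (simp_all add: algebra_simps)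
  have int: "f integrable_on {u..v}" for u v
    by (intro integrable_continuous_real continuous_on_subset[OF f]) auto
  have "integral {0..L} (\<lambda>x. f (x + c)) = integral {0..L} (\<lambda>x. f (x + r))"
    using peri[of "x + r" k for x] by (simp add: r_def algebra_simps)
  also have "\<dots> = integral {r..L + r} f"
    using integral_shift_real_ivl[of r r "L + r" f] by simp
  also have "\<dots> = integral {r..L} f + integral {L..L + r} f"
    using r by (intro Henstock_Kurzweil_Integration.integral_combine[symmetric] int) auto
  also have "integral {L..L + r} f = integral {0..r} f"
    using integral_shift_real_ivl[of L L "L + r" f] by (simp add: per)
  also have "integral {r..L} f + integral {0..r} f = integral {0..L} f"
    using r Henstock_Kurzweil_Integration.integral_combine[of 0 r L f] int by simp
  finally show ?thesis .
qed

text \<open>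
  \<open>1 - \<integral> q cos m\<phi> = \<integral> q (1 - cos m\<phi>)\<close> has a nonnegative integrand. Were it zero, then \<open>cos m\<phi> = 1\<close> almost
  everywhere, which fails on the whole interval between \<open>0\<close> and \<open>2\<pi> / m\<close>.
\<close>
lemma rate_pos:
  assumes "\<alpha> > 0" and q: "circle_density q" and m: "m \<ge> 1"
  shows "rate \<alpha> q m > 0"
proof (rule ccontr)
  let ?S = "{0..2 * pi}" and ?f = "\<lambda>\<phi>. q \<phi> * (1 - cos (real m * \<phi>))"
  assume neg: "\<not> ?thesis"
  have int: "(q has_integral 1) ?S" and pos: "q \<phi> > 0" for \<phi>
    using q by (auto simp: circle_density_def)
  have nn: "0 \<le> ?f \<phi>" for \<phi>
    using pos[of \<phi>] by (simp add: less_imp_le)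
  have wi: "(\<lambda>\<phi>. q \<phi> * h \<phi>) absolutely_integrable_on ?S" if "continuous_on ?S h" for h
    by (rule weighted_integrable) (use that int pos in \<open>auto simp: less_imp_le\<close>)
  have "integral ?S ?f = 1 - integral ?S (\<lambda>\<phi>. q \<phi> * cos (real m * \<phi>))"
    using int set_lebesgue_integral_eq_integral(1)[OF wi[of "\<lambda>\<phi>. cos (real m * \<phi>)"]]
    by (simp add: algebra_simps integral_diff continuous_intros has_integral_iff)
  then have "integral ?S ?f \<le> 0"
    using neg \<open>\<alpha> > 0\<close> by (simp add: rate_def not_less mult_le_0_iff)
  moreover have fi: "integrable (lebesgue_on ?S) ?f"
    using wi[of "\<lambda>\<phi>. 1 - cos (real m * \<phi>)"]
    by (simp add: set_integrable_def integrable_restrict_space continuous_intros)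
  ultimately have "(\<integral>x. ?f x \<partial>lebesgue_on ?S) = 0"
    using lebesgue_integral_eq_integral[OF fi] Bochner_Integration.integral_nonneg_AE[of ?f "lebesgue_on ?S"] nn by simp
  then have "AE x in lebesgue_on ?S. ?f x = 0"
    using integral_nonneg_eq_0_iff_AE[OF fi] nn by simp
  then have "AE x in lebesgue. x \<in> ?S \<longrightarrow> cos (real m * x) = 1"
    using pos by (simp add: AE_restrict_space_iff less_imp_neq[THEN not_sym])
  then have ae: "AE x in lebesgue. x \<notin> {0<..<2 * pi / real m}"
  proof (rule AE_mp, intro AE_I2 impI notI)
    fix x assume *: "x \<in> ?S \<longrightarrow> cos (real m * x) = 1" "x \<in> {0<..<2 * pi / real m}"
    have "x \<le> 2 * pi"
      using *(2) divide_left_mono[of 1 "real m" "2 * pi"] m by auto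
    then have c: "cos (real m * x) = 1" and x: "0 < real m * x" "real m * x < 2 * pi"
      using * m by (auto simp: pos_less_divide_eq mult.commute)
    obtain k :: int where k: "real m * x = of_int k * (2 * pi)"
      using c unfolding cos_one_2pi_int by (auto simp: algebra_simps)
    with x have "0 < k" "k < 1"
      by (auto simp: zero_less_mult_iff)
    then show False by simp
  qed
  then have "negligible {0<..<2 * pi / real m}"
    by (simp add: negligible_iff_null_sets AE_iff_null_sets)
  moreover have "2 * pi / real m > 0"
    using m by simp
  ultimately show False
    using negligible_interval(2)[of "0 :: real" "2 * pi / real m"] by fastforce
qed

section \<open>Exchanging the perturbation and the space derivative\<close>

text \<open>
  \<open>fm\<close> is at once the \<open>\<epsilon>\<close>-derivative of \<open>fx\<close> and the \<open>x\<close>-derivative of \<open>fe\<close>. Demanding this directly, rather than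
  through continuity of second derivatives and the theorem of Schwarz, makes the closure properties pure
  differentiation rules.
\<close>
definition exchange_derivs ::
  "(real \<Rightarrow> real \<Rightarrow> real) \<Rightarrow> (real \<Rightarrow> real \<Rightarrow> real) \<Rightarrow> (real \<Rightarrow> real \<Rightarrow> real) \<Rightarrow> (real \<Rightarrow> real \<Rightarrow> real) \<Rightarrow> bool"
  where
  "exchange_derivs f fx fe fm \<longleftrightarrow> (\<forall>\<epsilon> x.
     ((\<lambda>y. f \<epsilon> y) has_real_derivative fx \<epsilon> x) (at x) \<and>
     ((\<lambda>\<delta>. f \<delta> x) has_real_derivative fe \<epsilon> x) (at \<epsilon>) \<and>
     ((\<lambda>\<delta>. fx \<delta> x) has_real_derivative fm \<epsilon> x) (at \<epsilon>) \<and>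
     ((\<lambda>y. fe \<epsilon> y) has_real_derivative fm \<epsilon> x) (at x))"

definition exchangeable :: "(real \<Rightarrow> real \<Rightarrow> real) \<Rightarrow> bool" where
  "exchangeable f \<longleftrightarrow> (\<exists>fx fe fm. exchange_derivs f fx fe fm)"

lemma exchange_derivsD:
  assumes "exchange_derivs f fx fe fm"
  shows "((\<lambda>y. f \<epsilon> y) has_real_derivative fx \<epsilon> x) (at x)"
    "((\<lambda>\<delta>. f \<delta> x) has_real_derivative fe \<epsilon> x) (at \<epsilon>)"
    "((\<lambda>\<delta>. fx \<delta> x) has_real_derivative fm \<epsilon> x) (at \<epsilon>)"
    "((\<lambda>y. fe \<epsilon> y) has_real_derivative fm \<epsilon> x) (at x)"
  using assms unfolding exchange_derivs_def by blast+

lemma exchangeable_affine: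
  assumes "\<And>x. (a has_real_derivative a' x) (at x)" "\<And>x. (b has_real_derivative b' x) (at x)"
  shows "exchangeable (\<lambda>\<epsilon> x. a x + \<epsilon> * b x)"
  unfolding exchangeable_def exchange_derivs_def
  by (rule exI[of _ "\<lambda>\<epsilon> x. a' x + \<epsilon> * b' x"], rule exI[of _ "\<lambda>\<epsilon> x. b x"],
      rule exI[of _ "\<lambda>\<epsilon> x. b' x"]) (auto intro!: derivative_eq_intros assms)

lemma exchangeable_mult:
  assumes "exchangeable f" "exchangeable g"
  shows "exchangeable (\<lambda>\<epsilon> x. f \<epsilon> x * g \<epsilon> x)"
proof -
  obtain fx fe fm where "exchange_derivs f fx fe fm"
    using assms(1) unfolding exchangeable_def by blast
  note f = exchange_derivsD[OF this]
  obtain gx ge gm where "exchange_derivs g gx ge gm"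
    using assms(2) unfolding exchangeable_def by blast
  note g = exchange_derivsD[OF this]
  note [derivative_intros] =
    f(1)[THEN DERIV_chain2] f(2)[THEN DERIV_chain2] f(3)[THEN DERIV_chain2] f(4)[THEN DERIV_chain2]
    g(1)[THEN DERIV_chain2] g(2)[THEN DERIV_chain2] g(3)[THEN DERIV_chain2] g(4)[THEN DERIV_chain2]
  show ?thesis
    unfolding exchangeable_def exchange_derivs_def
    by (rule exI[of _ "\<lambda>\<epsilon> x. fx \<epsilon> x * g \<epsilon> x + f \<epsilon> x * gx \<epsilon> x"],
        rule exI[of _ "\<lambda>\<epsilon> x. fe \<epsilon> x * g \<epsilon> x + f \<epsilon> x * ge \<epsilon> x"],
        rule exI[of _ "\<lambda>\<epsilon> x. fm \<epsilon> x * g \<epsilon> x + fx \<epsilon> x * ge \<epsilon> x + fe \<epsilon> x * gx \<epsilon> x + f \<epsilon> x * gm \<epsilon> x"])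
       (auto intro!: derivative_eq_intros f g simp: algebra_simps)
qed

lemma exchangeable_compose:
  assumes f: "exchangeable f"
    and \<phi>: "\<And>u. (\<phi> has_real_derivative \<phi>' u) (at u)" "\<And>u. (\<phi>' has_real_derivative \<phi>'' u) (at u)"
  shows "exchangeable (\<lambda>\<epsilon> x. \<phi> (f \<epsilon> x))"
proof -
  obtain fx fe fm where "exchange_derivs f fx fe fm"
    using assms(1) unfolding exchangeable_def by blast
  note f = exchange_derivsD[OF this]
  note [derivative_intros] = \<phi>[THEN DERIV_chain2]
  show ?thesis
    unfolding exchangeable_def exchange_derivs_def
    by (rule exI[of _ "\<lambda>\<epsilon> x. \<phi>' (f \<epsilon> x) * fx \<epsilon> x"],
        rule exI[of _ "\<lambda>\<epsilon> x. \<phi>' (f \<epsilon> x) * fe \<epsilon> x"],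
        rule exI[of _ "\<lambda>\<epsilon> x. \<phi>'' (f \<epsilon> x) * fe \<epsilon> x * fx \<epsilon> x + \<phi>' (f \<epsilon> x) * fm \<epsilon> x"])
       (auto intro!: derivative_eq_intros f simp: algebra_simps)
qed

text \<open>
  For an \<open>L\<close>-periodic \<open>f\<close> both \<open>fx\<close> and \<open>fm\<close> are derivatives of periodic functions and so have mean zero. The
  gauge integral requires no continuity of these derivatives for the fundamental theorem.
\<close>
lemma exchangeable_obtain:
  assumes "exchangeable f" and per: "\<And>\<epsilon> x. f \<epsilon> (x + L) = f \<epsilon> x" and "L \<ge> 0"
  obtains fx fm where "\<And>\<epsilon> x. ((\<lambda>y. f \<epsilon> y) has_real_derivative fx \<epsilon> x) (at x)"
    "\<And>\<epsilon> x. ((\<lambda>\<delta>. fx \<delta> x) has_real_derivative fm \<epsilon> x) (at \<epsilon>)"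
    "\<And>\<epsilon>. (fx \<epsilon> has_integral 0) {0..L}" "\<And>\<epsilon>. (fm \<epsilon> has_integral 0) {0..L}"
proof -
  obtain fx fe fm where "exchange_derivs f fx fe fm"
    using assms(1) unfolding exchangeable_def by blast
  note f = exchange_derivsD[OF this]
  have ftc: "(u' has_integral 0) {0..L}"
    if "\<And>x. (u has_real_derivative u' x) (at x)" "u L = u 0" for u u'
    using fundamental_theorem_of_calculus[of 0 L u u'] that \<open>L \<ge> 0\<close>
    by (auto simp: has_real_derivative_iff_has_vector_derivative intro: has_vector_derivative_at_within)
  have "fe \<epsilon> L = fe \<epsilon> 0" for \<epsilon>
    using f(2)[where x = L and \<epsilon> = \<epsilon>] f(2)[where x = 0 and \<epsilon> = \<epsilon>] per[of _ 0] DERIV_unique by auto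
  then show ?thesis
    using per[of _ 0] by (intro that[of fx fm] f(1,3) ftc[OF f(1)] ftc[OF f(4)]) auto
qed

section \<open>Sensed densities\<close>

text \<open>In this form continuity of the kernel is visible.\<close>
lemma sensing_kernel_norm:
  fixes y :: "'a :: real_normed_vector"
  shows "sensing_kernel (norm y) = 3 * max 0 (1 - norm y) / pi"
  by (auto simp: sensing_kernel_def max_def)

text \<open>
  The kernel vanishes outside the unit disc, so that parameter integrals over a compact box become applicable.
\<close>
lemma sensed_density_cbox:
  "sensed_density G u x =
     integral (cbox (- 1) 1) (\<lambda>y :: real^2. sensing_kernel (norm y) * density G u (x - y $ 1))"
proof -
  have "sensing_kernel (norm y) = 0" if "y \<notin> cbox (- 1) 1" for y :: "real^2"
  proof -
    have "\<exists>i. \<bar>y $ i\<bar> > 1"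
    proof (rule ccontr)
      assume "\<nexists>i. \<bar>y $ i\<bar> > 1"
      then have "- 1 \<le> y $ i \<and> y $ i \<le> 1" for i
        by (meson abs_le_iff minus_le_iff not_less)
      with that show False by (simp add: mem_box_cart)
    qed
    then obtain i where "\<bar>y $ i\<bar> > 1" ..
    then have "norm y > 1" using component_le_norm_cart[of y i] by simp
    then show ?thesis by (simp add: sensing_kernel_def)
  qed
  then show ?thesis
    unfolding sensed_density_def
    by (subst integral_restrict_UNIV[symmetric]) (auto intro!: arg_cong[where f = "integral UNIV"])
qed

lemma continuous_density:
  assumes "continuous_on UNIV (\<lambda>(x, \<theta>). G u x \<theta>)"
  shows "continuous_on A (density G u)"
proof -
  have "continuous_on A (\<lambda>x. integral (cbox 0 (2 * pi)) (G u x))"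
    by (rule integral_continuous_on_param[OF continuous_on_subset[OF assms]]) auto
  then show ?thesis unfolding density_def by (auto intro!: continuous_intros)
qed

lemma integrable_sensing:
  assumes "continuous_on UNIV (\<lambda>(x, \<theta>). G u x \<theta>)"
  shows "(\<lambda>y :: real^2. sensing_kernel (norm y) * density G u (x - y $ 1)) integrable_on cbox (- 1) 1"
  unfolding sensing_kernel_norm
  by (intro integrable_continuous continuous_intros
      continuous_on_compose2[OF continuous_density[of G u, OF assms]]) auto

lemma density_superpose:
  assumes "continuous_on UNIV (\<lambda>(x, \<theta>). F u x \<theta>)" "continuous_on UNIV (\<lambda>(x, \<theta>). G u x \<theta>)"
  shows "density (\<lambda>s x \<theta>. F s x \<theta> + \<epsilon> * G s x \<theta>) u x = density F u x + \<epsilon> * density G u x"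
proof -
  have "continuous_on {0..2*pi} (F u x)" "continuous_on {0..2*pi} (G u x)"
    using continuous_on_slice[OF assms(1), of _ "\<lambda>_. x" "\<lambda>y. y"]
      continuous_on_slice[OF assms(2), of _ "\<lambda>_. x" "\<lambda>y. y"] by (auto intro: continuous_intros)
  then show ?thesis
    unfolding density_def
    by (subst integral_add) (auto intro!: integrable_continuous_real continuous_intros simp: add_divide_distrib)
qed

lemma sensed_density_superpose:
  assumes "continuous_on UNIV (\<lambda>(x, \<theta>). F u x \<theta>)" "continuous_on UNIV (\<lambda>(x, \<theta>). G u x \<theta>)"
  shows "sensed_density (\<lambda>s x \<theta>. F s x \<theta> + \<epsilon> * G s x \<theta>) u x
    = sensed_density F u x + \<epsilon> * sensed_density G u x"
proof -
  have "sensed_density F u x + \<epsilon> * sensed_density G u x =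
    integral (cbox (- 1) 1) (\<lambda>y :: real^2. sensing_kernel (norm y) * density F u (x - y $ 1)
      + \<epsilon> * (sensing_kernel (norm y) * density G u (x - y $ 1)))"
    unfolding sensed_density_cbox
    using integrable_sensing[of F u, OF assms(1), of x] integrable_sensing[of G u, OF assms(2), of x]
    by (subst integral_add) (auto intro: integrable_on_mult_right)
  then show ?thesis
    by (simp add: sensed_density_cbox density_superpose[of F u G, OF assms] algebra_simps)
qed

lemma sensed_density_differentiable:
  assumes "continuous_on UNIV (\<lambda>(x, \<theta>). G u x \<theta>)" "continuous_on UNIV (\<lambda>(x, \<theta>). Gx x \<theta>)"
    and d: "\<And>x \<theta>. ((\<lambda>y. G u y \<theta>) has_real_derivative Gx x \<theta>) (at x)"
  obtains \<sigma>' where "\<And>x. (sensed_density G u has_real_derivative \<sigma>' x) (at x)"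
proof -
  define \<rho>' where "\<rho>' x = integral {0..2*pi} (Gx x) / (2*pi)" for x
  have "((\<lambda>x. integral (cbox 0 (2*pi)) (G u x)) has_real_derivative integral (cbox 0 (2*pi)) (Gx x)) (at x within UNIV)" for x
    by (rule leibniz_rule_field_derivative)
       (auto intro!: d integrable_continuous_real continuous_on_slice[OF assms(1)]
         continuous_intros continuous_on_subset[OF assms(2)])
  then have \<rho>: "(density G u has_real_derivative \<rho>' x) (at x)" for x
    unfolding density_def \<rho>'_def by (auto intro!: derivative_eq_intros)
  have "continuous_on UNIV (\<lambda>x. integral (cbox 0 (2 * pi)) (Gx x))"
    by (rule integral_continuous_on_param[OF continuous_on_subset[OF assms(2)]]) auto
  then have \<rho>'c: "continuous_on UNIV \<rho>'" unfolding \<rho>'_def by (auto intro!: continuous_intros)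
  have "((\<lambda>x. integral (cbox (- 1) 1) (\<lambda>y :: real^2. sensing_kernel (norm y) * density G u (x - y $ 1)))
     has_real_derivative integral (cbox (- 1) 1) (\<lambda>y :: real^2. sensing_kernel (norm y) * \<rho>' (x - y $ 1))) (at x within UNIV)" for x
  proof (rule leibniz_rule_field_derivative)
    show "continuous_on (UNIV \<times> cbox (-1) 1) (\<lambda>(x, y :: real^2). sensing_kernel (norm y) * \<rho>' (x - y $ 1))"
      unfolding sensing_kernel_norm case_prod_beta'
      by (intro continuous_intros continuous_on_compose2[OF \<rho>'c]) auto
  qed (auto intro!: integrable_sensing[of G u] assms derivative_eq_intros DERIV_chain2[OF \<rho>])
  from this[unfolded sensed_density_cbox[symmetric]] show ?thesis
    by (rule that)
qed

lemma sensed_density_periodic: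
  "cell_periodic L G \<Longrightarrow> sensed_density G u (x + L) = sensed_density G u x"
proof -
  assume "cell_periodic L G"
  then have "density G u (y + L) = density G u y" for y
    by (simp add: density_def cell_periodic_def)
  from this[of "x - z" for z] show ?thesis
    unfolding sensed_density_def by (simp add: algebra_simps)
qed

section \<open>The flux drops out of the spatial mean\<close>

lemma regular_statesE:
  assumes "G \<in> regular_states L"
  obtains Gx Gxx where
    "continuous_on UNIV (\<lambda>(x, \<theta>). Gx x \<theta>)" "continuous_on UNIV (\<lambda>(x, \<theta>). Gxx x \<theta>)"
    "\<And>x \<theta>. ((\<lambda>y. G s y \<theta>) has_real_derivative Gx x \<theta>) (at x)"
    "\<And>x \<theta>. ((\<lambda>y. Gx y \<theta>) has_real_derivative Gxx x \<theta>) (at x)"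
proof -
  obtain Gx Gxx where
    "continuous_on UNIV (\<lambda>(x, \<theta>). Gx x \<theta>) \<and> continuous_on UNIV (\<lambda>(x, \<theta>). Gxx x \<theta>) \<and>
      (\<forall>x \<theta>. ((\<lambda>y. G s y \<theta>) has_real_derivative Gx x \<theta>) (at x) \<and>
               ((\<lambda>y. Gx y \<theta>) has_real_derivative Gxx x \<theta>) (at x))"
    using assms unfolding regular_states_def by blast
  then show ?thesis by (intro that[of Gx Gxx]) blast+
qed

lemma regular_states_continuous:
  "G \<in> regular_states L \<Longrightarrow> continuous_on UNIV (\<lambda>(x, \<theta>). G s x \<theta>)"
  unfolding regular_states_def by blast

lemma regular_states_periodic: "G \<in> regular_states L \<Longrightarrow> cell_periodic L G"
  unfolding regular_states_def by blast

lemma cell_periodicD: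
  assumes "cell_periodic L G"
  shows "G s (x + L) \<theta> = G s x \<theta>" "G s x (\<theta> + 2 * pi) = G s x \<theta>"
  using assms by (auto simp: cell_periodic_def)

text \<open>
  The sensed density depends linearly on the state, so along a line of states it is affine in \<open>\<epsilon>\<close>; the speeds
  are smooth functions of two such affine families, and the state itself is a third.
\<close>
lemma exchangeable_flux:
  fixes F G :: state
  assumes F: "F \<in> regular_states L" and G: "G \<in> regular_states L"
  defines "H \<equiv> \<lambda>\<epsilon> s x \<theta>. F s x \<theta> + \<epsilon> * G s x \<theta>"
  shows "exchangeable (\<lambda>\<epsilon> x. speed (H \<epsilon>) s x * cos \<theta> * H \<epsilon> s x \<theta>)"
proof -
  have sensed: "exchangeable (\<lambda>\<epsilon> x. sensed_density (H \<epsilon>) u x)" for u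
  proof -
    obtain \<sigma>' where \<sigma>': "\<And>x. (sensed_density F u has_real_derivative \<sigma>' x) (at x)"
      using regular_statesE[OF F, of u] sensed_density_differentiable[of F u, OF regular_states_continuous[OF F]]
      by metis
    obtain \<tau>' where \<tau>': "\<And>x. (sensed_density G u has_real_derivative \<tau>' x) (at x)"
      using regular_statesE[OF G, of u] sensed_density_differentiable[of G u, OF regular_states_continuous[OF G]]
      by metis
    show ?thesis
      unfolding H_def sensed_density_superpose[of F u G, OF regular_states_continuous[OF F] regular_states_continuous[OF G]]
      by (rule exchangeable_affine[OF \<sigma>' \<tau>'])
  qed
  have factor: "exchangeable (\<lambda>\<epsilon> x. 1 + 0.7 * tanh (c * (sensed_density (H \<epsilon>) u x - 1) / 0.7))" for c u
  proof (rule exchangeable_compose[OF sensed])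
    show "((\<lambda>w. 1 + 0.7 * tanh (c * (w - 1) / 0.7)) has_real_derivative
        c * (1 - (tanh (c * (w - 1) / 0.7))\<^sup>2)) (at w)" for w :: real
      by (auto intro!: derivative_eq_intros)
    show "((\<lambda>w. c * (1 - (tanh (c * (w - 1) / 0.7))\<^sup>2)) has_real_derivative
        c * (- 2 * tanh (c * (w - 1) / 0.7) * ((1 - (tanh (c * (w - 1) / 0.7))\<^sup>2) * (c / 0.7)))) (at w)" for w :: real
      by (auto intro!: derivative_eq_intros simp: power2_eq_square)
  qed
  have sp: "exchangeable (\<lambda>\<epsilon> x. speed (H \<epsilon>) s x)"
    using exchangeable_mult[OF factor factor] unfolding speed_def UNIV_2 by simp
  have cs: "exchangeable (\<lambda>\<epsilon> x. cos \<theta>)"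
    using exchangeable_affine[of "\<lambda>_. cos \<theta>" "\<lambda>_. 0" "\<lambda>_. 0" "\<lambda>_. 0"] by simp
  have st: "exchangeable (\<lambda>\<epsilon> x. H \<epsilon> s x \<theta>)"
    unfolding H_def
    by (rule regular_statesE[OF F, of s], rule regular_statesE[OF G, of s], rule exchangeable_affine)
  show ?thesis
    by (intro exchangeable_mult sp cs st)
qed

definition collision :: "(real \<Rightarrow> real) \<Rightarrow> (real \<Rightarrow> real) \<Rightarrow> real \<Rightarrow> real" where
  "collision q h \<theta> = integral {0..2 * pi} (\<lambda>\<phi>. q \<phi> * (h (\<theta> - \<phi>) - h \<theta>))"

lemma collision_superpose:
  assumes q: "circle_density q" and f: "continuous_on UNIV f" and h: "continuous_on UNIV h"
  shows "collision q (\<lambda>\<theta>. f \<theta> + \<epsilon> * h \<theta>) \<theta> = collision q f \<theta> + \<epsilon> * collision q h \<theta>"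
proof -
  have int: "(\<lambda>\<phi>. q \<phi> * (k (\<theta> - \<phi>) - k \<theta>)) integrable_on {0..2 * pi}" if "continuous_on UNIV k" for k
    by (rule set_lebesgue_integral_eq_integral(1), rule weighted_integrable)
       (use q in \<open>auto simp: circle_density_def less_imp_le
          intro!: continuous_intros continuous_on_compose2[OF that]\<close>)
  have "collision q f \<theta> + \<epsilon> * collision q h \<theta> = integral {0..2 * pi}
     (\<lambda>\<phi>. q \<phi> * (f (\<theta> - \<phi>) - f \<theta>) + \<epsilon> * (q \<phi> * (h (\<theta> - \<phi>) - h \<theta>)))"
    unfolding collision_def by (subst integral_add) (use int[OF f] integrable_on_mult_right[OF int[OF h]] in auto)
  then show ?thesis
    by (simp add: collision_def algebra_simps)
qed

lemma continuous_angle_slice: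
  assumes "continuous_on UNIV (\<lambda>(x, \<theta>). g x \<theta>)"
  shows "continuous_on A (g x)"
  using continuous_on_slice[OF assms, of A "\<lambda>_. x" "\<lambda>y. y"] by (simp add: continuous_intros)

lemma speed_periodic: "cell_periodic L G \<Longrightarrow> speed G s (x + L) = speed G s x"
  by (simp add: speed_def sensed_density_periodic)

text \<open>
  Only the flux term \<open>fx\<close> depends nonlinearly on \<open>\<epsilon>\<close>. Taking \<open>\<epsilon> = 0\<close> yields the kinetic equation, and
  differentiating at \<open>\<epsilon> = 0\<close> yields its linearisation, whose transport term is \<open>fm\<close>.
\<close>
lemma flux_decomposition:
  fixes F G :: state
  assumes L: "L > 0" and q: "circle_density q" and F: "F \<in> regular_states L" and G: "G \<in> regular_states L"
  obtains fx fm where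
    "\<And>\<epsilon> x. kinetic_rhs Dt \<alpha> q (\<lambda>s x \<theta>. F s x \<theta> + \<epsilon> * G s x \<theta>) s x \<theta> = - fx \<epsilon> x +
       Dt * ((deriv ^^ 2) (\<lambda>y. F s y \<theta>) x + \<epsilon> * (deriv ^^ 2) (\<lambda>y. G s y \<theta>) x) +
       \<alpha> * (collision q (F s x) \<theta> + \<epsilon> * collision q (G s x) \<theta>)"
    "\<And>\<epsilon> x. ((\<lambda>\<delta>. fx \<delta> x) has_real_derivative fm \<epsilon> x) (at \<epsilon>)"
    "\<And>\<epsilon>. (fx \<epsilon> has_integral 0) {0..L}" "\<And>\<epsilon>. (fm \<epsilon> has_integral 0) {0..L}"
proof -
  define H where "H \<equiv> \<lambda>\<epsilon> s x \<theta>. F s x \<theta> + \<epsilon> * G s x \<theta>"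
  have "cell_periodic L (H \<epsilon>)" for \<epsilon>
    using regular_states_periodic[OF F] regular_states_periodic[OF G]
    by (auto simp: cell_periodic_def H_def)
  then have per: "speed (H \<epsilon>) s (x + L) * cos \<theta> * H \<epsilon> s (x + L) \<theta> = speed (H \<epsilon>) s x * cos \<theta> * H \<epsilon> s x \<theta>" for \<epsilon> x
    by (simp add: speed_periodic cell_periodicD)
  have flux: "exchangeable (\<lambda>\<epsilon> x. speed (H \<epsilon>) s x * cos \<theta> * H \<epsilon> s x \<theta>)"
    unfolding H_def by (rule exchangeable_flux[OF F G])
  obtain fx fm where f:
    "\<And>\<epsilon> x. ((\<lambda>y. speed (H \<epsilon>) s y * cos \<theta> * H \<epsilon> s y \<theta>) has_real_derivative fx \<epsilon> x) (at x)"
    "\<And>\<epsilon> x. ((\<lambda>\<delta>. fx \<delta> x) has_real_derivative fm \<epsilon> x) (at \<epsilon>)"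
    "\<And>\<epsilon>. (fx \<epsilon> has_integral 0) {0..L}" "\<And>\<epsilon>. (fm \<epsilon> has_integral 0) {0..L}"
    by (rule exchangeable_obtain[OF flux per less_imp_le[OF L]], rule that)
  obtain Fx Fxx where Fx:
    "\<And>x \<theta>. ((\<lambda>y. F s y \<theta>) has_real_derivative Fx x \<theta>) (at x)"
    "\<And>x \<theta>. ((\<lambda>y. Fx y \<theta>) has_real_derivative Fxx x \<theta>) (at x)"
    using regular_statesE[OF F] by metis
  obtain Gx Gxx where Gx:
    "\<And>x \<theta>. ((\<lambda>y. G s y \<theta>) has_real_derivative Gx x \<theta>) (at x)"
    "\<And>x \<theta>. ((\<lambda>y. Gx y \<theta>) has_real_derivative Gxx x \<theta>) (at x)"
    using regular_statesE[OF G] by metis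
  have d1: "deriv (\<lambda>y. H \<epsilon> s y \<theta>) = (\<lambda>x. Fx x \<theta> + \<epsilon> * Gx x \<theta>)"
    "deriv (\<lambda>y. F s y \<theta>) = (\<lambda>x. Fx x \<theta>)" "deriv (\<lambda>y. G s y \<theta>) = (\<lambda>x. Gx x \<theta>)" for \<epsilon>
    unfolding H_def by (auto intro!: ext DERIV_imp_deriv derivative_eq_intros Fx Gx)
  have d2: "deriv (\<lambda>x. Fx x \<theta> + \<epsilon> * Gx x \<theta>) = (\<lambda>x. Fxx x \<theta> + \<epsilon> * Gxx x \<theta>)"
    "deriv (\<lambda>y. Fx y \<theta>) = (\<lambda>x. Fxx x \<theta>)" "deriv (\<lambda>y. Gx y \<theta>) = (\<lambda>x. Gxx x \<theta>)" for \<epsilon>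
    by (auto intro!: ext DERIV_imp_deriv derivative_eq_intros Fx Gx)
  have "kinetic_rhs Dt \<alpha> q (H \<epsilon>) s x \<theta> = - fx \<epsilon> x +
       Dt * ((deriv ^^ 2) (\<lambda>y. F s y \<theta>) x + \<epsilon> * (deriv ^^ 2) (\<lambda>y. G s y \<theta>) x) +
       \<alpha> * collision q (H \<epsilon> s x) \<theta>" for \<epsilon> x
    unfolding kinetic_rhs_def DERIV_imp_deriv[OF f(1)] collision_def
    by (simp add: numeral_2_eq_2 d1 d2)
  moreover have "collision q (H \<epsilon> s x) \<theta> = collision q (F s x) \<theta> + \<epsilon> * collision q (G s x) \<theta>" for \<epsilon> x
    unfolding H_def
    by (intro collision_superpose q continuous_angle_slice[of "F s"] continuous_angle_slice[of "G s"]
        regular_states_continuous[OF F] regular_states_continuous[OF G])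
  ultimately show ?thesis
    using that[of fx fm] f unfolding H_def by auto
qed

text \<open>
  \<open>R\<close> plays the role of the time derivative of \<open>G\<close>. This abstraction is what the nonlinear and the linearised
  equation share: their transport terms differ, but both are total space derivatives of periodic functions.
\<close>

definition transport_free :: "real \<Rightarrow> real \<Rightarrow> real \<Rightarrow> (real \<Rightarrow> real) \<Rightarrow> state \<Rightarrow> state \<Rightarrow> bool" where
  "transport_free L Dt \<alpha> q G R \<longleftrightarrow> (\<forall>s \<theta>.
     ((\<lambda>x. R s x \<theta> - Dt * (deriv ^^ 2) (\<lambda>y. G s y \<theta>) x - \<alpha> * collision q (G s x) \<theta>) has_integral 0) {0..L})"

lemma transport_free_kinetic:
  assumes "L > 0" "circle_density q" "F \<in> regular_states L"
  shows "transport_free L Dt \<alpha> q F (kinetic_rhs Dt \<alpha> q F)"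
  unfolding transport_free_def
proof (intro allI)
  fix s \<theta>
  show "((\<lambda>x. kinetic_rhs Dt \<alpha> q F s x \<theta> - Dt * (deriv ^^ 2) (\<lambda>y. F s y \<theta>) x - \<alpha> * collision q (F s x) \<theta>)
     has_integral 0) {0..L}"
  proof (rule flux_decomposition[OF assms(1-3) assms(3), of Dt \<alpha> s \<theta>])
    fix fx fm :: "real \<Rightarrow> real \<Rightarrow> real"
    assume *: "\<And>\<epsilon> x. kinetic_rhs Dt \<alpha> q (\<lambda>s x \<theta>. F s x \<theta> + \<epsilon> * F s x \<theta>) s x \<theta> = - fx \<epsilon> x +
       Dt * ((deriv ^^ 2) (\<lambda>y. F s y \<theta>) x + \<epsilon> * (deriv ^^ 2) (\<lambda>y. F s y \<theta>) x) +
       \<alpha> * (collision q (F s x) \<theta> + \<epsilon> * collision q (F s x) \<theta>)" "\<And>\<epsilon>. (fx \<epsilon> has_integral 0) {0..L}"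
    show ?thesis
      using *(1)[of 0] has_integral_neg[OF *(2)[of 0]] by simp
  qed
qed

lemma transport_free_linearised:
  assumes "L > 0" "circle_density q" "F \<in> regular_states L" "G \<in> regular_states L"
    and lin: "\<And>s x \<theta>. ((\<lambda>\<epsilon>. kinetic_rhs Dt \<alpha> q (\<lambda>s x \<theta>. F s x \<theta> + \<epsilon> * G s x \<theta>) s x \<theta>)
             has_real_derivative R s x \<theta>) (at 0)"
  shows "transport_free L Dt \<alpha> q G R"
  unfolding transport_free_def
proof (intro allI)
  fix s \<theta>
  show "((\<lambda>x. R s x \<theta> - Dt * (deriv ^^ 2) (\<lambda>y. G s y \<theta>) x - \<alpha> * collision q (G s x) \<theta>)
     has_integral 0) {0..L}"
  proof (rule flux_decomposition[OF assms(1-4), of Dt \<alpha> s \<theta>])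
    fix fx fm :: "real \<Rightarrow> real \<Rightarrow> real"
    assume *: "\<And>\<epsilon> x. kinetic_rhs Dt \<alpha> q (\<lambda>s x \<theta>. F s x \<theta> + \<epsilon> * G s x \<theta>) s x \<theta> = - fx \<epsilon> x +
       Dt * ((deriv ^^ 2) (\<lambda>y. F s y \<theta>) x + \<epsilon> * (deriv ^^ 2) (\<lambda>y. G s y \<theta>) x) +
       \<alpha> * (collision q (F s x) \<theta> + \<epsilon> * collision q (G s x) \<theta>)"
      "\<And>\<epsilon> x. ((\<lambda>\<delta>. fx \<delta> x) has_real_derivative fm \<epsilon> x) (at \<epsilon>)"
      "\<And>\<epsilon>. (fm \<epsilon> has_integral 0) {0..L}"
    have "R s x \<theta> = - fm 0 x + Dt * (deriv ^^ 2) (\<lambda>y. G s y \<theta>) x + \<alpha> * collision q (G s x) \<theta>" for x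
      by (rule DERIV_unique[OF lin[of s x \<theta>, unfolded *(1)]])
         (auto intro!: derivative_eq_intros *(2))
    then show ?thesis
      using has_integral_neg[OF *(3)[of 0]] by simp
  qed
qed

section \<open>Moments and spatial profiles\<close>

text \<open>The form suited to differentiation under the integral sign.\<close>
lemma moment_double_integral:
  assumes "continuous_on UNIV (\<lambda>(x, \<theta>). G s x \<theta>)"
  shows "moment L s m G =
    integral (cbox (0, 0) (L, 2 * pi)) (\<lambda>(x, \<theta>). G s x \<theta> * cos (real m * \<theta>) / (2 * pi))"
proof -
  have "continuous_on (cbox (0, 0) (L, 2 * pi)) (\<lambda>(x, \<theta>). G s x \<theta> * cos (real m * \<theta>) / (2 * pi))"
    unfolding case_prod_beta' by (intro continuous_intros continuous_on_slice[OF assms]) auto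
  then show ?thesis
    by (simp add: moment_def integral_prod_continuous)
qed

text \<open>The form showing that moments are cosine coefficients of the spatial profile.\<close>
lemma moment_profile:
  assumes "continuous_on UNIV (\<lambda>(x, \<theta>). G s x \<theta>)"
  shows "moment L s m G =
    integral {0..2 * pi} (\<lambda>\<theta>. integral {0..L} (\<lambda>x. G s x \<theta>) * cos (real m * \<theta>)) / (2 * pi)"
proof -
  have "continuous_on (cbox (0, 0) (L, 2 * pi)) (\<lambda>(x, \<theta>). G s x \<theta> * cos (real m * \<theta>) / (2 * pi))"
    unfolding case_prod_beta' by (intro continuous_intros continuous_on_slice[OF assms]) auto
  from integral_swap_continuous[OF this] show ?thesis
    by (simp add: moment_def)
qed

lemma continuous_profile:
  fixes g :: "real \<Rightarrow> real \<Rightarrow> real"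
  assumes "continuous_on UNIV (\<lambda>(x, \<theta>). g x \<theta>)"
  shows "continuous_on A (\<lambda>\<theta>. integral {0..L} (\<lambda>x. g x \<theta>))"
proof -
  have "continuous_on A (\<lambda>\<theta>. integral (cbox 0 L) (\<lambda>x. g x \<theta>))"
    by (rule integral_continuous_on_param)
       (auto simp: case_prod_beta' intro!: continuous_intros continuous_on_slice[OF assms])
  then show ?thesis by simp
qed

lemma continuous_position_slice:
  assumes "continuous_on UNIV (\<lambda>(x, \<theta>). g x \<theta>)"
  shows "continuous_on A (\<lambda>x. g x \<theta>)"
  using continuous_on_slice[OF assms, of A "\<lambda>x. x" "\<lambda>_. \<theta>"] by (simp add: continuous_intros)

text \<open>
  After exchanging the integrals and shifting the angle, the addition theorem produces a cosine and a sine
  coefficient of \<open>q\<close>. Evenness of \<open>q\<close> removes the sine coefficient, and the cosine coefficient is what enters the rate.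
\<close>
lemma collision_cosine:
  assumes q: "circle_density q" and h: "continuous_on UNIV h" and per: "\<And>\<theta>. h (\<theta> + 2 * pi) = h \<theta>"
  shows "\<alpha> * integral {0..2 * pi} (\<lambda>\<theta>. collision q h \<theta> * cos (real m * \<theta>)) =
     - rate \<alpha> q m * integral {0..2 * pi} (\<lambda>\<theta>. h \<theta> * cos (real m * \<theta>))"
proof -
  let ?S = "{0..2 * pi}"
  let ?m = "real m"
  define C where "C = integral ?S (\<lambda>\<theta>. h \<theta> * cos (?m * \<theta>))"
  define D where "D = integral ?S (\<lambda>\<theta>. h \<theta> * sin (?m * \<theta>))"
  have qi: "q integrable_on ?S" and q0: "0 \<le> q \<phi>"
    and q_even: "q (- \<phi>) = q \<phi>" and q_per: "q (\<phi> + 2 * pi) = q \<phi>" for \<phi>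
    using q by (auto simp: circle_density_def less_imp_le integrable_on_def)
  have wi: "(\<lambda>\<phi>. q \<phi> * k \<phi>) integrable_on ?S" if "continuous_on ?S k" for k
    by (rule set_lebesgue_integral_eq_integral(1), rule weighted_integrable[OF qi q0 that])
  have shift: "integral ?S (\<lambda>\<theta>. h (\<theta> - \<phi>) * cos (?m * \<theta>)) = cos (?m * \<phi>) * C - sin (?m * \<phi>) * D" for \<phi>
  proof -
    have "integral ?S (\<lambda>\<theta>. h (\<theta> - \<phi>) * cos (?m * \<theta>)) =
        integral ?S (\<lambda>\<theta>. h \<theta> * cos (?m * (\<theta> + \<phi>)))"
    proof -
      have "cos (?m * (\<theta> + 2 * pi + \<phi>)) = cos (?m * (\<theta> + \<phi>))" for \<theta>
        using cos.plus_of_nat[of "?m * (\<theta> + \<phi>)" m] by (simp add: algebra_simps)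
      then show ?thesis
        using integral_periodic_shift[of "2 * pi" "\<lambda>\<theta>. h \<theta> * cos (?m * (\<theta> + \<phi>))" "- \<phi>"]
        by (simp add: continuous_intros h per)
    qed
    also have "\<dots> = integral ?S (\<lambda>\<theta>. cos (?m * \<phi>) * (h \<theta> * cos (?m * \<theta>)) - sin (?m * \<phi>) * (h \<theta> * sin (?m * \<theta>)))"
      by (simp add: cos_add distrib_left algebra_simps)
    also have "\<dots> = cos (?m * \<phi>) * C - sin (?m * \<phi>) * D"
      unfolding C_def D_def
      by (subst integral_diff)
         (auto intro!: integrable_continuous_real continuous_intros continuous_on_subset[OF h])
    finally show ?thesis .
  qed
  \<comment> \<open>The reflection \<open>\<phi> \<mapsto> 2\<pi> - \<phi>\<close> preserves \<open>q\<close> by evenness and periodicity.\<close>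
  have odd: "integral ?S (\<lambda>\<phi>. q \<phi> * sin (?m * \<phi>)) = 0"
  proof -
    have refl: "q (2 * pi - \<phi>) * sin (?m * (2 * pi - \<phi>)) = - (q \<phi> * sin (?m * \<phi>))" for \<phi>
      using sin.plus_of_nat[of "- (?m * \<phi>)" m] q_per[of "- \<phi>"] q_even[of \<phi>]
      by (simp add: algebra_simps)
    have "integral ?S (\<lambda>\<phi>. q \<phi> * sin (?m * \<phi>)) =
        integral {- (2 * pi)..0} (\<lambda>\<phi>. q (- \<phi>) * sin (?m * (- \<phi>)))"
      using Henstock_Kurzweil_Integration.integral_reflect_real[of "2 * pi" 0 "\<lambda>\<phi>. q \<phi> * sin (?m * \<phi>)"] by simp
    also have "\<dots> = integral ?S (\<lambda>\<phi>. q (2 * pi - \<phi>) * sin (?m * (2 * pi - \<phi>)))"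
      using integral_shift_real_ivl[of "- (2 * pi)" "- (2 * pi)" 0 "\<lambda>\<phi>. q (- \<phi>) * sin (?m * (- \<phi>))"]
      by simp
    also have "\<dots> = - integral ?S (\<lambda>\<phi>. q \<phi> * sin (?m * \<phi>))"
      by (simp add: refl)
    finally show ?thesis by simp
  qed
  have "continuous_on UNIV (\<lambda>(\<theta>, \<phi>). (h (\<theta> - \<phi>) - h \<theta>) * cos (?m * \<theta>))"
    unfolding case_prod_beta' by (intro continuous_intros continuous_on_compose2[OF h]) auto
  from integral_unique[OF has_integral_weighted_swap[OF qi q0 this, of 0 "2 * pi"]]
  have "integral ?S (\<lambda>\<theta>. collision q h \<theta> * cos (?m * \<theta>)) =
      integral ?S (\<lambda>\<phi>. q \<phi> * integral ?S (\<lambda>\<theta>. (h (\<theta> - \<phi>) - h \<theta>) * cos (?m * \<theta>)))"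
    by (simp add: collision_def mult.assoc[symmetric])
  also have "\<dots> = integral ?S (\<lambda>\<phi>. q \<phi> * cos (?m * \<phi>) * C - q \<phi> * sin (?m * \<phi>) * D - q \<phi> * C)"
  proof -
    have "integral ?S (\<lambda>\<theta>. (h (\<theta> - \<phi>) - h \<theta>) * cos (?m * \<theta>)) =
      cos (?m * \<phi>) * C - sin (?m * \<phi>) * D - C" for \<phi>
    proof -
      have "integral ?S (\<lambda>\<theta>. (h (\<theta> - \<phi>) - h \<theta>) * cos (?m * \<theta>)) =
          integral ?S (\<lambda>\<theta>. h (\<theta> - \<phi>) * cos (?m * \<theta>)) - C"
        unfolding left_diff_distrib C_def
        by (intro integral_diff integrable_continuous_real continuous_intros continuous_on_compose2[OF h]) auto
      then show ?thesis by (simp add: shift)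
    qed
    then have "q \<phi> * integral ?S (\<lambda>\<theta>. (h (\<theta> - \<phi>) - h \<theta>) * cos (?m * \<theta>)) =
      q \<phi> * cos (?m * \<phi>) * C - q \<phi> * sin (?m * \<phi>) * D - q \<phi> * C" for \<phi>
      by (simp only: right_diff_distrib mult.assoc)
    then show ?thesis
      by (simp only:)
  qed
  also have "\<dots> = (integral ?S (\<lambda>\<phi>. q \<phi> * cos (?m * \<phi>)) - 1) * C"
  proof -
    have "((\<lambda>\<phi>. q \<phi> * cos (?m * \<phi>) * C - q \<phi> * sin (?m * \<phi>) * D - q \<phi> * C) has_integral
        integral ?S (\<lambda>\<phi>. q \<phi> * cos (?m * \<phi>)) * C - 0 * D - 1 * C) ?S"
    proof (intro has_integral_diff has_integral_mult_left)
      show "(q has_integral 1) ?S"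
        using q by (simp add: circle_density_def)
      show "((\<lambda>\<phi>. q \<phi> * sin (?m * \<phi>)) has_integral 0) ?S"
        using integrable_integral[OF wi[of "\<lambda>\<phi>. sin (?m * \<phi>)"]] odd by (simp add: continuous_intros)
    qed (intro integrable_integral wi continuous_intros)
    then show ?thesis
      by (simp add: integral_unique left_diff_distrib)
  qed
  finally have "integral ?S (\<lambda>\<theta>. collision q h \<theta> * cos (?m * \<theta>)) =
      (integral ?S (\<lambda>\<phi>. q \<phi> * cos (?m * \<phi>)) - 1) * C" .
  then show ?thesis
    unfolding rate_def C_def[symmetric] by (simp only:) (simp add: algebra_simps)
qed

text \<open>
  The spatial mean of the diffusion term vanishes because \<open>Gx\<close> is periodic, and averaging in \<open>x\<close> commutes with the
  collision operator. Hence the profile of \<open>R\<close> is \<open>\<alpha>\<close> times the collision operator of the profile of \<open>G\<close>.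
\<close>
lemma moment_balance:
  assumes L: "L > 0" and q: "circle_density q" and G: "G \<in> regular_states L"
    and R: "continuous_on UNIV (\<lambda>(x, \<theta>). R s x \<theta>)"
    and free: "transport_free L Dt \<alpha> q G R"
  shows "moment L s m R = - rate \<alpha> q m * moment L s m G"
proof -
  let ?h = "\<lambda>\<theta>. integral {0..L} (\<lambda>x. G s x \<theta>)"
  note Gc = regular_states_continuous[OF G, of s]
  note Gp = cell_periodicD[OF regular_states_periodic[OF G]]
  have q': "q integrable_on {0..2*pi}" "\<And>\<phi>. 0 \<le> q \<phi>"
    using q by (auto simp: circle_density_def less_imp_le integrable_on_def)
  \<comment> \<open>The closed equation for the spatial profile.\<close>
  have profile: "integral {0..L} (\<lambda>x. R s x \<theta>) = \<alpha> * collision q ?h \<theta>" for \<theta>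
  proof -
    obtain Gx Gxx where Gx:
      "\<And>x \<theta>. ((\<lambda>y. G s y \<theta>) has_real_derivative Gx x \<theta>) (at x)"
      "\<And>x \<theta>. ((\<lambda>y. Gx y \<theta>) has_real_derivative Gxx x \<theta>) (at x)"
      using regular_statesE[OF G] by metis
    have d: "deriv (\<lambda>y. G s y \<theta>) = (\<lambda>x. Gx x \<theta>)" "deriv (\<lambda>y. Gx y \<theta>) = (\<lambda>x. Gxx x \<theta>)"
      by (auto intro!: ext DERIV_imp_deriv Gx)
    have Gx0: "Gx L \<theta> = Gx 0 \<theta>"
    proof (rule DERIV_unique[OF Gx(1)])
      have "((\<lambda>y. G s (y + - L) \<theta>) has_real_derivative Gx 0 \<theta>) (at L)"
        using Gx(1)[of \<theta> 0] DERIV_shift[of "\<lambda>y. G s y \<theta>" "Gx 0 \<theta>" L "- L"] by simp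
      moreover have "G s (y + - L) \<theta> = G s y \<theta>" for y
        using Gp(1)[of s "y - L" \<theta>] by simp
      ultimately show "((\<lambda>y. G s y \<theta>) has_real_derivative Gx 0 \<theta>) (at L)"
        by simp
    qed
    have diff: "((\<lambda>x. Gxx x \<theta>) has_integral 0) {0..L}"
      using fundamental_theorem_of_calculus[of 0 L "\<lambda>x. Gx x \<theta>" "\<lambda>x. Gxx x \<theta>"] L Gx(2) Gx0
      by (auto simp: has_real_derivative_iff_has_vector_derivative intro: has_vector_derivative_at_within)
    have "continuous_on UNIV (\<lambda>(x, \<phi>). G s x (\<theta> - \<phi>) - G s x \<theta>)"
      unfolding case_prod_beta' by (intro continuous_intros continuous_on_slice[OF Gc])
    from has_integral_weighted_swap[OF q' this, of 0 L]
    have coll: "((\<lambda>x. collision q (G s x) \<theta>) has_integral collision q ?h \<theta>) {0..L}"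
      unfolding collision_def
      by (subst (asm) integral_diff)
         (auto intro!: integrable_continuous_real continuous_position_slice[OF Gc])
    have "((\<lambda>x. (R s x \<theta> - Dt * Gxx x \<theta> - \<alpha> * collision q (G s x) \<theta>) + Dt * Gxx x \<theta>
        + \<alpha> * collision q (G s x) \<theta>) has_integral 0 + Dt * 0 + \<alpha> * collision q ?h \<theta>) {0..L}"
      using free[unfolded transport_free_def, rule_format, of s \<theta>]
      by (intro has_integral_add has_integral_mult_right diff coll) (simp add: numeral_2_eq_2 d)
    then show ?thesis
      by (simp add: integral_unique)
  qed
  have "?h (\<theta> + 2 * pi) = ?h \<theta>" for \<theta>
    by (simp add: Gp)
  from collision_cosine[OF q continuous_profile[OF Gc] this, of \<alpha> m]
  show ?thesis
    unfolding moment_profile[of R s, OF R] moment_profile[of G s, OF Gc] profile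
    by (simp add: mult.assoc)
qed

section \<open>The decay law\<close>

lemma regular_evolution_states:
  assumes "regular_evolution L I G R" "t \<in> I"
  shows "G t \<in> regular_states L" "continuous_on UNIV (\<lambda>(x, \<theta>). R t s x \<theta>)"
proof -
  have slice: "continuous_on UNIV (\<lambda>(x, \<theta>). f t x \<theta>)"
    if "continuous_on (I \<times> UNIV) (\<lambda>(t, x, \<theta>). f t x \<theta>)" for f :: "real \<Rightarrow> real \<Rightarrow> real \<Rightarrow> real"
    using continuous_on_compose2[OF that, of UNIV "\<lambda>p. (t, p)"] \<open>t \<in> I\<close>
    by (auto simp: continuous_intros case_prod_beta')
  have reg: "\<exists>Gx Gxx.
        continuous_on (I \<times> UNIV) (\<lambda>(t, x, \<theta>). G t s x \<theta>) \<and>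
        continuous_on (I \<times> UNIV) (\<lambda>(t, x, \<theta>). R t s x \<theta>) \<and>
        continuous_on (I \<times> UNIV) (\<lambda>(t, x, \<theta>). Gx t x \<theta>) \<and>
        continuous_on (I \<times> UNIV) (\<lambda>(t, x, \<theta>). Gxx t x \<theta>) \<and>
        (\<forall>t\<in>I. \<forall>x \<theta>.
           ((\<lambda>\<tau>. G \<tau> s x \<theta>) has_real_derivative R t s x \<theta>) (at t within I) \<and>
           ((\<lambda>y. G t s y \<theta>) has_real_derivative Gx t x \<theta>) (at x) \<and>
           ((\<lambda>y. Gx t y \<theta>) has_real_derivative Gxx t x \<theta>) (at x))" for s
    using assms(1) unfolding regular_evolution_def by blast
  have "\<exists>Gx Gxx.
        continuous_on UNIV (\<lambda>(x, \<theta>). G t s x \<theta>) \<and>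
        continuous_on UNIV (\<lambda>(x, \<theta>). Gx x \<theta>) \<and>
        continuous_on UNIV (\<lambda>(x, \<theta>). Gxx x \<theta>) \<and>
        (\<forall>x \<theta>. ((\<lambda>y. G t s y \<theta>) has_real_derivative Gx x \<theta>) (at x) \<and>
               ((\<lambda>y. Gx y \<theta>) has_real_derivative Gxx x \<theta>) (at x))" for s
    using reg[of s] slice \<open>t \<in> I\<close> by (elim exE conjE) (intro exI conjI, auto)
  then show "G t \<in> regular_states L"
    using assms unfolding regular_states_def regular_evolution_def by blast
  have "continuous_on (I \<times> UNIV) (\<lambda>(t, x, \<theta>). R t s x \<theta>)"
    using reg[of s] by blast
  then show "continuous_on UNIV (\<lambda>(x, \<theta>). R t s x \<theta>)"
    by (rule slice)
qed

lemma regular_evolution_time_derivative: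
  assumes "regular_evolution L I G R" "t \<in> I"
  shows "((\<lambda>\<tau>. G \<tau> s x \<theta>) has_real_derivative R t s x \<theta>) (at t within I)"
  using assms unfolding regular_evolution_def by blast

lemma moment_leibniz:
  assumes G: "regular_evolution L I G R" and I: "is_interval I" and t: "t \<in> I"
  shows "((\<lambda>\<tau>. moment L s m (G \<tau>)) has_real_derivative moment L s m (R t)) (at t within I)"
proof -
  note slices = regular_evolution_states[OF G]
  have Rc: "continuous_on (I \<times> UNIV) (\<lambda>(t, x, \<theta>). R t s x \<theta>)"
    using G unfolding regular_evolution_def by blast
  let ?B = "cbox (0, 0) (L, 2 * pi)"
  have "((\<lambda>\<tau>. integral ?B (\<lambda>(x, \<theta>). G \<tau> s x \<theta> * cos (real m * \<theta>) / (2 * pi))) has_real_derivative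
       integral ?B (\<lambda>(x, \<theta>). R t s x \<theta> * cos (real m * \<theta>) / (2 * pi))) (at t within I)"
  proof (rule leibniz_rule_field_derivative)
    fix \<tau> and p :: "real \<times> real" assume "\<tau> \<in> I"
    show "((\<lambda>\<tau>. case p of (x, \<theta>) \<Rightarrow> G \<tau> s x \<theta> * cos (real m * \<theta>) / (2 * pi)) has_real_derivative
        (case p of (x, \<theta>) \<Rightarrow> R \<tau> s x \<theta> * cos (real m * \<theta>) / (2 * pi))) (at \<tau> within I)"
      by (cases p) (auto intro!: derivative_eq_intros regular_evolution_time_derivative[OF G] \<open>\<tau> \<in> I\<close>)
  next
    fix \<tau> assume "\<tau> \<in> I"
    show "(\<lambda>(x, \<theta>). G \<tau> s x \<theta> * cos (real m * \<theta>) / (2 * pi)) integrable_on ?B"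
      unfolding case_prod_beta'
      by (intro integrable_continuous continuous_intros
          continuous_on_slice[OF regular_states_continuous[OF slices(1)[OF \<open>\<tau> \<in> I\<close>]]]) auto
  next
    have "continuous_on (I \<times> ?B) (\<lambda>p. R (fst p) s (fst (snd p)) (snd (snd p)))"
      using continuous_on_subset[OF Rc, of "I \<times> ?B"] by (auto simp: case_prod_beta')
    then show "continuous_on (I \<times> ?B) (\<lambda>(t, p). case p of (x, \<theta>) \<Rightarrow> R t s x \<theta> * cos (real m * \<theta>) / (2 * pi))"
      unfolding case_prod_beta' by (intro continuous_intros) auto
  qed (use t I in \<open>auto simp: is_interval_convex\<close>)
  then have "((\<lambda>\<tau>. integral ?B (\<lambda>(x, \<theta>). G \<tau> s x \<theta> * cos (real m * \<theta>) / (2 * pi))) has_real_derivative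
       moment L s m (R t)) (at t within I)"
    by (simp add: moment_double_integral[of "R t" s, OF slices(2)[OF t]])
  then show ?thesis
    by (rule has_field_derivative_transform_within[OF _ zero_less_one t])
       (simp add: moment_double_integral[OF regular_states_continuous[OF slices(1)]])
qed

text \<open>
  The explicit form comes from the integrating factor \<open>exp (\<gamma>\<^sub>m t)\<close>. Since \<open>I\<close> may be a compact interval, the
  derivatives are one-sided at its ends and constancy is inferred from convexity.
\<close>
lemma moment_ode_solution:
  assumes G: "regular_evolution L I G R" and I: "is_interval I"
    and L: "L > 0" and q: "circle_density q"
    and free: "\<And>t. t \<in> I \<Longrightarrow> transport_free L Dt \<alpha> q (G t) (R t)"
  shows "t \<in> I \<Longrightarrow> ((\<lambda>\<tau>. moment L s m (G \<tau>)) has_real_derivative - rate \<alpha> q m * moment L s m (G t)) (at t within I)"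
    and "t \<in> I \<Longrightarrow> u \<in> I \<Longrightarrow> moment L s m (G u) = exp (- rate \<alpha> q m * (u - t)) * moment L s m (G t)"
proof -
  have d: "((\<lambda>\<tau>. moment L s m (G \<tau>)) has_real_derivative - rate \<alpha> q m * moment L s m (G t)) (at t within I)"
    if "t \<in> I" for t
    using moment_leibniz[OF G I that, of s m]
      moment_balance[OF L q regular_evolution_states[OF G that] free[OF that], of s m] by simp
  then show "t \<in> I \<Longrightarrow> ((\<lambda>\<tau>. moment L s m (G \<tau>)) has_real_derivative - rate \<alpha> q m * moment L s m (G t)) (at t within I)" .
  assume "t \<in> I" "u \<in> I"
  have "((\<lambda>\<tau>. exp (rate \<alpha> q m * \<tau>) * moment L s m (G \<tau>)) has_real_derivative 0) (at \<tau> within I)" if "\<tau> \<in> I" for \<tau>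
    by (rule derivative_eq_intros d[OF that] refl | simp)+
  then obtain c where "\<And>\<tau>. \<tau> \<in> I \<Longrightarrow> exp (rate \<alpha> q m * \<tau>) * moment L s m (G \<tau>) = c"
    using has_field_derivative_zero_constant[of I "\<lambda>\<tau>. exp (rate \<alpha> q m * \<tau>) * moment L s m (G \<tau>)"] I
    by (auto simp: is_interval_convex)
  then have "exp (rate \<alpha> q m * u) * moment L s m (G u) = exp (rate \<alpha> q m * t) * moment L s m (G t)"
    using \<open>t \<in> I\<close> \<open>u \<in> I\<close> by simp
  then show "moment L s m (G u) = exp (- rate \<alpha> q m * (u - t)) * moment L s m (G t)"
    by (simp add: exp_diff exp_minus field_simps right_diff_distrib)
qed

section \<open>Invariance of moments and phase directions\<close>

lemma regular_statesI:
  assumes "cell_periodic L G"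
    and "\<And>s. \<exists>Gx Gxx. continuous_on UNIV (\<lambda>(x, \<theta>). G s x \<theta>) \<and>
        continuous_on UNIV (\<lambda>(x, \<theta>). Gx x \<theta>) \<and> continuous_on UNIV (\<lambda>(x, \<theta>). Gxx x \<theta>) \<and>
        (\<forall>x \<theta>. ((\<lambda>y. G s y \<theta>) has_real_derivative Gx x \<theta>) (at x) \<and>
               ((\<lambda>y. Gx y \<theta>) has_real_derivative Gxx x \<theta>) (at x))"
  shows "G \<in> regular_states L"
  using assms unfolding regular_states_def by blast

lemma regular_states_translate:
  assumes G: "G \<in> regular_states L"
  shows "translate a G \<in> regular_states L"
proof (rule regular_statesI)
  have "G s (x + L - a) \<theta> = G s (x - a) \<theta>" for s x \<theta>
    using cell_periodicD(1)[OF regular_states_periodic[OF G], of s "x - a" \<theta>] by (simp add: algebra_simps)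
  then show "cell_periodic L (translate a G)"
    by (simp add: cell_periodic_def translate_def cell_periodicD[OF regular_states_periodic[OF G]])
  fix s
  obtain Gx Gxx where Gx:
    "continuous_on UNIV (\<lambda>(x, \<theta>). Gx x \<theta>)" "continuous_on UNIV (\<lambda>(x, \<theta>). Gxx x \<theta>)"
    "\<And>x \<theta>. ((\<lambda>y. G s y \<theta>) has_real_derivative Gx x \<theta>) (at x)"
    "\<And>x \<theta>. ((\<lambda>y. Gx y \<theta>) has_real_derivative Gxx x \<theta>) (at x)"
    by (rule regular_statesE[OF G, of s], rule that)
  have c: "continuous_on UNIV (\<lambda>(x, \<theta>). g (x - a) \<theta>)" if "continuous_on UNIV (\<lambda>(x, \<theta>). g x \<theta>)"
    for g :: "real \<Rightarrow> real \<Rightarrow> real"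
    unfolding case_prod_beta' by (intro continuous_on_slice[OF that] continuous_intros)
  have d: "((\<lambda>y. g (y - a)) has_real_derivative g' (x - a)) (at x)"
    if "\<And>x. (g has_real_derivative g' x) (at x)" for g g' :: "real \<Rightarrow> real" and x
    using DERIV_shift[of g "g' (x - a)" x "- a"] that by simp
  show "\<exists>Gx Gxx. continuous_on UNIV (\<lambda>(x, \<theta>). translate a G s x \<theta>) \<and>
        continuous_on UNIV (\<lambda>(x, \<theta>). Gx x \<theta>) \<and> continuous_on UNIV (\<lambda>(x, \<theta>). Gxx x \<theta>) \<and>
        (\<forall>x \<theta>. ((\<lambda>y. translate a G s y \<theta>) has_real_derivative Gx x \<theta>) (at x) \<and>
               ((\<lambda>y. Gx y \<theta>) has_real_derivative Gxx x \<theta>) (at x))"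
    unfolding translate_def
    by (rule exI[of _ "\<lambda>x. Gx (x - a)"], rule exI[of _ "\<lambda>x. Gxx (x - a)"])
       (auto intro!: c Gx(1,2) regular_states_continuous[OF G]
          d[where g = "\<lambda>y. G s y \<theta>" for \<theta>] d[where g = "\<lambda>y. Gx y \<theta>" for \<theta>] Gx(3,4))
qed

lemma regular_states_superpose:
  assumes G: "G \<in> regular_states L" and H: "H \<in> regular_states L"
  shows "(\<lambda>s x \<theta>. G s x \<theta> + c * H s x \<theta>) \<in> regular_states L"
proof (rule regular_statesI)
  show "cell_periodic L (\<lambda>s x \<theta>. G s x \<theta> + c * H s x \<theta>)"
    using regular_states_periodic[OF G] regular_states_periodic[OF H] by (simp add: cell_periodic_def)
  fix s
  obtain Gx Gxx where Gx:
    "continuous_on UNIV (\<lambda>(x, \<theta>). Gx x \<theta>)" "continuous_on UNIV (\<lambda>(x, \<theta>). Gxx x \<theta>)"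
    "\<And>x \<theta>. ((\<lambda>y. G s y \<theta>) has_real_derivative Gx x \<theta>) (at x)"
    "\<And>x \<theta>. ((\<lambda>y. Gx y \<theta>) has_real_derivative Gxx x \<theta>) (at x)"
    by (rule regular_statesE[OF G, of s], rule that)
  obtain Hx Hxx where Hx:
    "continuous_on UNIV (\<lambda>(x, \<theta>). Hx x \<theta>)" "continuous_on UNIV (\<lambda>(x, \<theta>). Hxx x \<theta>)"
    "\<And>x \<theta>. ((\<lambda>y. H s y \<theta>) has_real_derivative Hx x \<theta>) (at x)"
    "\<And>x \<theta>. ((\<lambda>y. Hx y \<theta>) has_real_derivative Hxx x \<theta>) (at x)"
    by (rule regular_statesE[OF H, of s], rule that)
  have c: "continuous_on UNIV (\<lambda>(x, \<theta>). g x \<theta> + c * h x \<theta>)"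
    if "continuous_on UNIV (\<lambda>(x, \<theta>). g x \<theta>)" "continuous_on UNIV (\<lambda>(x, \<theta>). h x \<theta>)"
    for g h :: "real \<Rightarrow> real \<Rightarrow> real"
    using that unfolding case_prod_beta' by (intro continuous_intros)
  show "\<exists>Kx Kxx. continuous_on UNIV (\<lambda>(x, \<theta>). G s x \<theta> + c * H s x \<theta>) \<and>
        continuous_on UNIV (\<lambda>(x, \<theta>). Kx x \<theta>) \<and> continuous_on UNIV (\<lambda>(x, \<theta>). Kxx x \<theta>) \<and>
        (\<forall>x \<theta>. ((\<lambda>y. G s y \<theta> + c * H s y \<theta>) has_real_derivative Kx x \<theta>) (at x) \<and>
               ((\<lambda>y. Kx y \<theta>) has_real_derivative Kxx x \<theta>) (at x))"
    by (rule exI[of _ "\<lambda>x \<theta>. Gx x \<theta> + c * Hx x \<theta>"], rule exI[of _ "\<lambda>x \<theta>. Gxx x \<theta> + c * Hxx x \<theta>"])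
       (auto intro!: c Gx Hx regular_states_continuous[OF G] regular_states_continuous[OF H]
          derivative_eq_intros)
qed

lemma moment_superpose:
  assumes G: "G \<in> regular_states L" and H: "H \<in> regular_states L"
  shows "moment L s m (\<lambda>s x \<theta>. G s x \<theta> + c * H s x \<theta>) = moment L s m G + c * moment L s m H"
proof -
  let ?B = "cbox (0, 0) (L, 2 * pi)"
  have i: "(\<lambda>(x, \<theta>). K s x \<theta> * cos (real m * \<theta>) / (2 * pi)) integrable_on ?B"
    if "K \<in> regular_states L" for K
    unfolding case_prod_beta'
    by (intro integrable_continuous continuous_intros
          continuous_on_slice[OF regular_states_continuous[OF that]]) auto
  have "moment L s m G + c * moment L s m H = integral ?B (\<lambda>p.
      (case p of (x, \<theta>) \<Rightarrow> G s x \<theta> * cos (real m * \<theta>) / (2 * pi)) +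
      c * (case p of (x, \<theta>) \<Rightarrow> H s x \<theta> * cos (real m * \<theta>) / (2 * pi)))"
    using i[OF G] integrable_on_mult_right[OF i[OF H], of c]
    by (simp add: moment_double_integral[of G s, OF regular_states_continuous[OF G]]
      moment_double_integral[of H s, OF regular_states_continuous[OF H]] integral_add)
  also have "\<dots> = moment L s m (\<lambda>s x \<theta>. G s x \<theta> + c * H s x \<theta>)"
    unfolding moment_double_integral[of "\<lambda>s x \<theta>. G s x \<theta> + c * H s x \<theta>" s,
        OF regular_states_continuous[OF regular_states_superpose[OF G H]]]
    by (intro arg_cong[where f = "integral ?B"] ext) (auto simp: field_simps)
  finally show ?thesis ..
qed

lemma moment_translate:
  assumes L: "L > 0" and G: "G \<in> regular_states L"
  shows "moment L s m (translate a G) = moment L s m G"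
proof -
  have "integral {0..L} (\<lambda>x. translate a G s x \<theta>) = integral {0..L} (\<lambda>x. G s x \<theta>)" for \<theta>
    using integral_periodic_shift[OF L continuous_position_slice[OF regular_states_continuous[OF G]], of s \<theta> "- a"]
    by (simp add: translate_def cell_periodicD[OF regular_states_periodic[OF G]])
  then show ?thesis
    by (simp add: moment_profile[of G s, OF regular_states_continuous[OF G]]
      moment_profile[of "translate a G" s, OF regular_states_continuous[OF regular_states_translate[OF G]]])
qed

text \<open>
  An eigenvalue of the dual needs a functional that does not vanish; the mode \<open>cos m\<theta>\<close>, constant in space, detects it.
\<close>
lemma exists_moment_nonzero:
  assumes L: "L > 0"
  shows "\<exists>h\<in>regular_states L. moment L s m h \<noteq> 0"
proof
  define h :: state where "h s x \<theta> = cos (real m * \<theta>)" for s x \<theta>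
  have "cos (real m * (\<theta> + 2 * pi)) = cos (real m * \<theta>)" for \<theta>
    using cos.plus_of_nat[of "real m * \<theta>" m] by (simp add: algebra_simps)
  then have "cell_periodic L h"
    by (simp add: cell_periodic_def h_def)
  moreover have "continuous_on UNIV (\<lambda>(x, \<theta>). h s x \<theta>)" for s
    unfolding h_def case_prod_beta' by (intro continuous_intros)
  ultimately show h: "h \<in> regular_states L"
    by (intro regular_statesI exI[of _ "\<lambda>_ _. 0"]) (auto simp: h_def)
  have "integral {0..2 * pi} (\<lambda>\<theta>. cos (real m * \<theta>) * cos (real m * \<theta>)) \<noteq> 0"
    by (subst integral_eq_0_iff) (auto intro!: continuous_intros bexI[of _ 0])
  then show "moment L s m h \<noteq> 0"
    using L by (simp add: moment_def h_def)
qed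

lemma moment_translation_phase:
  assumes L: "L > 0" and F: "F 0 \<in> regular_states L" and T: "translation_phase F \<in> regular_states L"
  shows "moment L s m (translation_phase F) = 0"
proof -
  have "integral {0..L} (\<lambda>x. translation_phase F s x \<theta>) = 0" for \<theta>
  proof -
    obtain Fx Fxx where Fx: "\<And>x \<theta>. ((\<lambda>y. F 0 s y \<theta>) has_real_derivative Fx x \<theta>) (at x)"
      by (rule regular_statesE[OF F, of s], rule that)
    have "((\<lambda>x. Fx x \<theta>) has_integral F 0 s L \<theta> - F 0 s 0 \<theta>) {0..L}"
      using L Fx
      by (intro fundamental_theorem_of_calculus)
         (auto simp: has_real_derivative_iff_has_vector_derivative intro: has_vector_derivative_at_within)
    then show ?thesis
      using cell_periodicD(1)[OF regular_states_periodic[OF F], of s 0 \<theta>]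
      by (simp add: translation_phase_def DERIV_imp_deriv[OF Fx] integral_unique)
  qed
  then show ?thesis
    by (simp add: moment_profile[of "translation_phase F" s, OF regular_states_continuous[OF T]])
qed

section \<open>Left factors of the period map\<close>

lemma left_factor_iff:
  "left_factor X M l \<mu> \<longleftrightarrow> (\<exists>h\<in>X. l h \<noteq> 0) \<and> (\<forall>h\<in>X. l (M h) = \<mu> * l h)"
  unfolding left_factor_def dual_map_def by (auto simp: restrict_def fun_eq_iff)

theorem propositionS28:
  fixes L Dt \<alpha> :: real and q :: "real \<Rightarrow> real"
  assumes "L > 0" and "Dt > 0" and "\<alpha> > 0" and "circle_density q"
  shows
    "(\<forall>I F. regular_solution L Dt \<alpha> q I F \<longrightarrow>
        (\<forall>s. \<forall>m\<ge>1. \<forall>t\<in>I.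
           ((\<lambda>\<tau>. moment L s m (F \<tau>)) has_real_derivative - rate \<alpha> q m * moment L s m (F t))
             (at t within I))) \<and>
     (\<forall>P a F. relative_periodic_state L Dt \<alpha> q P a F \<longrightarrow>
        (\<forall>s. \<forall>m\<ge>1. \<forall>t. moment L s m (F t) = 0) \<and>
        (\<forall>M. linearised_period_map L Dt \<alpha> q P a F M \<longrightarrow>
           (\<forall>s. \<forall>m\<ge>1.
              left_factor (regular_states L) M (moment L s m) (exp (- rate \<alpha> q m * P)) \<and>
              (\<forall>Q. phase_alignment L F Q \<longrightarrow>
                 left_factor (regular_states L) (Q \<circ> M) (moment L s m) (exp (- rate \<alpha> q m * P)) \<and>
                 left_factor (Q ` regular_states L) (Q \<circ> M) (moment L s m)
                   (exp (- rate \<alpha> q m * P))))))"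
proof -
  note L = \<open>L > 0\<close> and q = \<open>circle_density q\<close>
  have solution: "\<exists>R. regular_evolution L I F R \<and> is_interval I \<and>
      (\<forall>t\<in>I. transport_free L Dt \<alpha> q (F t) (R t))" if sol: "regular_solution L Dt \<alpha> q I F" for I F
  proof -
    obtain R where R: "regular_evolution L I F R" "\<And>t s x \<theta>. t \<in> I \<Longrightarrow> R t s x \<theta> = kinetic_rhs Dt \<alpha> q (F t) s x \<theta>"
      using sol unfolding regular_solution_def by blast
    have "transport_free L Dt \<alpha> q (F t) (R t)" if "t \<in> I" for t
    proof -
      have "R t = kinetic_rhs Dt \<alpha> q (F t)"
        using R(2)[OF that] by (intro ext)
      then show ?thesis
        using transport_free_kinetic[OF L q regular_evolution_states(1)[OF R(1) that]] by simp
    qed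
    with R(1) sol show ?thesis unfolding regular_solution_def by blast
  qed
  have part1: "((\<lambda>\<tau>. moment L s m (F \<tau>)) has_real_derivative - rate \<alpha> q m * moment L s m (F t)) (at t within I)"
    if sol: "regular_solution L Dt \<alpha> q I F" and "t \<in> I" for I F s m t
    using solution[OF sol] moment_ode_solution(1)[OF _ _ L q _ \<open>t \<in> I\<close>] by blast
  have part2: "(\<forall>s. \<forall>m\<ge>1. \<forall>t. moment L s m (F t) = 0) \<and>
        (\<forall>M. linearised_period_map L Dt \<alpha> q P a F M \<longrightarrow>
           (\<forall>s. \<forall>m\<ge>1.
              left_factor (regular_states L) M (moment L s m) (exp (- rate \<alpha> q m * P)) \<and>
              (\<forall>Q. phase_alignment L F Q \<longrightarrow>
                 left_factor (regular_states L) (Q \<circ> M) (moment L s m) (exp (- rate \<alpha> q m * P)) \<and>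
                 left_factor (Q ` regular_states L) (Q \<circ> M) (moment L s m)
                   (exp (- rate \<alpha> q m * P)))))"
    if rel: "relative_periodic_state L Dt \<alpha> q P a F" for P a F
  proof -
    have P: "P > 0" and shift: "\<And>t. F (t + P) = translate a (F t)"
      and sol: "regular_solution L Dt \<alpha> q UNIV F"
      using rel unfolding relative_periodic_state_def by auto
    obtain R where R: "regular_evolution L UNIV F R"
      and free: "\<And>t. transport_free L Dt \<alpha> q (F t) (R t)"
      using solution[OF sol] by auto
    have Freg: "F t \<in> regular_states L" for t
      by (rule regular_evolution_states(1)[OF R]) simp
    have zero: "moment L s m (F t) = 0" if "m \<ge> 1" for s m t
    proof -
      have "moment L s m (F t) = exp (- rate \<alpha> q m * P) * moment L s m (F t)"
        using moment_ode_solution(2)[OF R _ L q free, of t "t + P" s m]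
        by (simp add: shift moment_translate[OF L Freg])
      moreover have "exp (- rate \<alpha> q m * P) < 1"
        using rate_pos[OF \<open>\<alpha> > 0\<close> q that] P by simp
      ultimately show ?thesis by auto
    qed
    have "left_factor (regular_states L) M (moment L s m) (exp (- rate \<alpha> q m * P)) \<and>
              (\<forall>Q. phase_alignment L F Q \<longrightarrow>
                 left_factor (regular_states L) (Q \<circ> M) (moment L s m) (exp (- rate \<alpha> q m * P)) \<and>
                 left_factor (Q ` regular_states L) (Q \<circ> M) (moment L s m)
                   (exp (- rate \<alpha> q m * P)))"
      if M: "linearised_period_map L Dt \<alpha> q P a F M" and m: "m \<ge> 1" for M s m
    proof -
      let ?X = "regular_states L" and ?\<mu> = "exp (- rate \<alpha> q m * P)"
      have Mh: "M h \<in> ?X" "moment L s m (M h) = ?\<mu> * moment L s m h" if h: "h \<in> ?X" for h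
      proof -
        obtain g where g: "linearised_solution L Dt \<alpha> q F {0..P} g" "g 0 = h" "M h = translate (- a) (g P)"
          using M h unfolding linearised_period_map_def by blast
        obtain g' where g': "regular_evolution L {0..P} g g'"
          and lin: "\<And>t s x \<theta>. t \<in> {0..P} \<Longrightarrow>
            ((\<lambda>\<epsilon>. kinetic_rhs Dt \<alpha> q (\<lambda>s x \<theta>. F t s x \<theta> + \<epsilon> * g t s x \<theta>) s x \<theta>)
             has_real_derivative g' t s x \<theta>) (at 0)"
          using g(1) unfolding linearised_solution_def by blast
        have greg: "g t \<in> ?X" if "t \<in> {0..P}" for t
          by (rule regular_evolution_states(1)[OF g' that])
        have "transport_free L Dt \<alpha> q (g t) (g' t)" if "t \<in> {0..P}" for t
          by (rule transport_free_linearised[OF L q Freg greg[OF that] lin[OF that]])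
        from moment_ode_solution(2)[OF g' _ L q this, of 0 P s m] P
        have "moment L s m (g P) = ?\<mu> * moment L s m h"
          by (simp add: g(2) is_interval_cc)
        then show "moment L s m (M h) = ?\<mu> * moment L s m h"
          using P by (simp add: g(3) moment_translate[OF L greg])
        show "M h \<in> ?X"
          using P by (simp add: g(3) regular_states_translate[OF greg])
      qed
      have "left_factor ?X (Q \<circ> M) (moment L s m) ?\<mu> \<and> left_factor (Q ` ?X) (Q \<circ> M) (moment L s m) ?\<mu>"
        if Q: "phase_alignment L F Q" for Q
      proof -
        let ?T = "translation_phase F" and ?S = "temporal_phase F"
        obtain b c where T: "?T \<in> ?X" and S: "?S \<in> ?X"
          and Qh: "\<And>h. h \<in> ?X \<Longrightarrow> Q h = (\<lambda>s x \<theta>. h s x \<theta> - b h * ?T s x \<theta> - c h * ?S s x \<theta>)"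
          using Q unfolding phase_alignment_def by blast
        have "?S = R 0"
          using regular_evolution_time_derivative[OF R, of 0]
          unfolding temporal_phase_def by (intro ext DERIV_imp_deriv) simp
        then have S0: "moment L s m ?S = 0"
          using moment_balance[OF L q Freg regular_evolution_states(2)[OF R] free, of 0 s m]
          by (simp add: zero[OF m])
        have T0: "moment L s m ?T = 0"
          by (rule moment_translation_phase[OF L Freg T])
        have Qh2: "Q h = (\<lambda>s x \<theta>. (h s x \<theta> + (- b h) * ?T s x \<theta>) + (- c h) * ?S s x \<theta>)"
          if "h \<in> ?X" for h
          by (simp add: Qh[OF that])
        \<comment> \<open>\<open>Q\<close> is only described on regular states, so \<open>M h \<in> ?X\<close> is what makes \<open>Q (M h)\<close> accessible.\<close>
        have Qreg: "Q h \<in> ?X" and Qmom: "moment L s m (Q h) = moment L s m h" if h: "h \<in> ?X" for h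
          unfolding Qh2[OF h]
          using regular_states_superpose[OF regular_states_superpose[OF h T] S]
            moment_superpose[OF regular_states_superpose[OF h T] S] moment_superpose[OF h T]
          by (simp_all only: S0 T0 mult_zero_right add_0_right)
        show ?thesis
          unfolding left_factor_iff using exists_moment_nonzero[OF L, of s m] Mh Qreg Qmom by auto
      qed
      then show ?thesis
        unfolding left_factor_iff using exists_moment_nonzero[OF L, of s m] Mh by auto
    qed
    with zero show ?thesis by blast
  qed
  show ?thesis
    using part1 part2 by blast
qed

end
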